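(* Let $\Gamma$ be a finite, simple, strongly connected digraph of order $n\geq 4$ which is not an undirected graph. Then $\dim(\Gamma)=n-2$ if and only if $\Gamma$ is isomorphic to one of $G_2[K_1,P_2,K_1]$, $G_1[K_1,K_t,K_{n-t-1}]$, $G_2[K_1,K_t,K_{n-t-1}]$, $G_2[K_t,K_{n-t-1},K_1]$, or $G_2[K_1,\overline{K}_{n-2},K_1]$ for some integer $t$ with $1\leq t\leq n-2$.
   Context: All digraphs are finite, simple (no loops, at most one arc from $x$ to $y$ for each ordered pair) and strongly connected. $\partial(x,y)$ is the length of a shortest directed path from $x$ to $y$; $\tilde\partial(x,y)=(\partial(x,y),\partial(y,x))$. A subset $\{w_1,\dots,w_m\}$ of $V(\Gamma)$ is a weakly resolving set if $(\tilde\partial(w_1,u),\dots,\tilde\partial(w_m,u))\neq(\tilde\partial(w_1,v),\dots,\tilde\partial(w_m,v))$ for all distinct vertices $u,v$; $\dim(\Gamma)$ (weak metric dimension) is the minimum size of a weakly resolving set. A digraph is an undirected graph if for every arc $(x,y)$, $(y,x)$ is also an arc. $K_t$ is the complete digraph on $t$ vertices (all ordered pairs of distinct vertices are arcs), $\overline{K}_t$ the digraph on $t$ vertices with no arcs, and $P_2$ the digraph on two vertices $a,b$ with the single arc $(a,b)$. $G_1$ is the digraph on $\{0,1,2\}$ with arcs $(0,1),(1,2),(2,1),(2,0)$; $G_2$ is the digraph on $\{0,1,2\}$ with arcs $(0,1),(1,0),(1,2),(2,1),(2,0)$. For a digraph $G$ on $\{0,1,\dots,m-1\}$ and digraphs $H_0,\dots,H_{m-1}$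 with disjoint vertex sets, the generalized lexicographic product $G[H_0,\dots,H_{m-1}]$ has vertex set $V(H_0)\cup\dots\cup V(H_{m-1})$, and for $x\in V(H_i)$, $y\in V(H_j)$ there is an arc $(x,y)$ iff either $i=j$ and $(x,y)$ is an arc of $H_i$, or $i\neq j$ and $(i,j)$ is an arc of $G$. *)

theory Defs
  imports "Graph_Theory.Graph_Theory"
begin

text \<open>
  Distances are only meaningful when \<^term>\<open>v\<close> is reachable from \<^term>\<open>u\<close>; in a strongly
  connected digraph this holds for all pairs of vertices.
\<close>
definition digraph_dist :: "('a, 'b) pre_digraph \<Rightarrow> 'a \<Rightarrow> 'a \<Rightarrow> nat" where
  "digraph_dist G u v = (LEAST k. \<exists>p. pre_digraph.apath G u p v \<and> length p = k)"

definition two_way_dist :: "('a, 'b) pre_digraph \<Rightarrow> 'a \<Rightarrow> 'a \<Rightarrow> nat \<times> nat" where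
  "two_way_dist G u v = (digraph_dist G u v, digraph_dist G v u)"

definition weakly_resolving :: "('a, 'b) pre_digraph \<Rightarrow> 'a set \<Rightarrow> bool" where
  "weakly_resolving G W \<longleftrightarrow> finite W \<and> W \<subseteq> verts G \<and>
     (\<forall>u \<in> verts G. \<forall>v \<in> verts G. u \<noteq> v \<longrightarrow>
        (\<exists>w \<in> W. two_way_dist G w u \<noteq> two_way_dist G w v))"

definition weak_metric_dim :: "('a, 'b) pre_digraph \<Rightarrow> nat" where
  "weak_metric_dim G = (LEAST k. \<exists>W. weakly_resolving G W \<and> card W = k)"

definition K_digraph :: "nat \<Rightarrow> nat pair_pre_digraph" where
  "K_digraph t = \<lparr> pverts = {..<t}, parcs = {(x, y). x < t \<and> y < t \<and> x \<noteq> y} \<rparr>"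

definition arcless_digraph :: "nat \<Rightarrow> nat pair_pre_digraph" where
  "arcless_digraph t = \<lparr> pverts = {..<t}, parcs = {} \<rparr>"

definition P2_digraph :: "nat pair_pre_digraph" where
  "P2_digraph = \<lparr> pverts = {0, 1}, parcs = {(0, 1)} \<rparr>"

definition G1_digraph :: "nat pair_pre_digraph" where
  "G1_digraph = \<lparr> pverts = {0, 1, 2}, parcs = {(0, 1), (1, 2), (2, 1), (2, 0)} \<rparr>"

definition G2_digraph :: "nat pair_pre_digraph" where
  "G2_digraph = \<lparr> pverts = {0, 1, 2}, parcs = {(0, 1), (1, 0), (1, 2), (2, 1), (2, 0)} \<rparr>"

text \<open>
  The generalized lexicographic product \<open>G[H\<^sub>0, \<dots>, H\<^bsub>m-1\<^esub>]\<close>, for \<open>G\<close> a digraph on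
  \<open>{0, \<dots>, m-1}\<close> and \<open>Hs = [H\<^sub>0, \<dots>, H\<^bsub>m-1\<^esub>]\<close>. Tagging each vertex of \<open>H\<^sub>i\<close> with \<open>i\<close>
  makes the vertex sets of the factors disjoint.
\<close>
definition gen_lex_prod ::
    "nat pair_pre_digraph \<Rightarrow> 'a pair_pre_digraph list \<Rightarrow> (nat \<times> 'a) pair_pre_digraph" where
  "gen_lex_prod G Hs =
    \<lparr> pverts = (SIGMA i : {..<length Hs}. pverts (Hs ! i)),
      parcs = {((i, x), (j, y)) | i x j y.
        i < length Hs \<and> x \<in> pverts (Hs ! i) \<and> j < length Hs \<and> y \<in> pverts (Hs ! j) \<and>
        (i = j \<and> (x, y) \<in> parcs (Hs ! i) \<or> i \<noteq> j \<and> (i, j) \<in> parcs G)} \<rparr>"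

lemma complete_digraph_K_digraph: "complete_digraph t (with_proj (K_digraph t))"
proof -
  have "finite {(x, y). x < t \<and> y < t \<and> x \<noteq> y}"
    by (rule finite_subset[of _ "{..<t} \<times> {..<t}"]) auto
  then have "graph (with_proj (K_digraph t))"
    by unfold_locales
      (auto simp: K_digraph_def with_proj_def arc_to_ends_def symmetric_def arcs_ends_def sym_def)
  then show ?thesis
    by (auto simp: complete_digraph_def K_digraph_def)
qed

end

theory Submission
  imports Defs
begin

text \<open>
  A set of vertices resolves if and only if it separates the vertices outside it. So the dimension
  is at most \<open>n - k\<close> exactly when some \<open>k\<close> vertices are pairwise separated by the remaining ones;
  two such vertices exist if the digraph is not symmetric, and the question is when three do not.
  The first three steps of a geodesic of length at least 3 form a triple separated by its initial
  vertex; hence distances are at most 2 and only adjacency matters.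

  Without a separated triple, a vertex \<open>z\<close> that sees \<open>x\<close> and \<open>x'\<close> alike but \<open>y\<close> differently forces
  every vertex outside \<open>{x, x', y}\<close> to see \<open>x\<close> and \<open>x'\<close> alike; moreover each vertex sees at most
  two of the types ``mutual arc'', ``outgoing single arc'', ``incoming single arc'', ``no arc''.
  If some \<open>z\<close> has both an outgoing and an incoming single arc, it follows that all other pairs are
  mutual, which gives \<open>G\<^sub>1[K\<^sub>1, K\<^sub>t, K\<^bsub>n-t-1\<^esub>]\<close>. Otherwise no tail of a single arc is a head of
  another, and all pairs are mutual except the single arcs and some pairs of vertices on no single
  arc. Two disjoint single arcs force \<open>n = 4\<close> and \<open>G\<^sub>2[K\<^sub>1, P\<^sub>2, K\<^sub>1]\<close>. If there are none, the
  single arcs form a star, and the vertices on no single arc are pairwise joined or, if there is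
  only one single arc, possibly pairwise non-adjacent.
\<close>

section \<open>Sets separated from outside\<close>

definition outer_separated :: "'a set \<Rightarrow> ('a \<Rightarrow> 'a \<Rightarrow> 'c) \<Rightarrow> 'a set \<Rightarrow> bool" where
  "outer_separated V f T \<longleftrightarrow> T \<subseteq> V \<and> pairwise (\<lambda>u v. \<exists>w\<in>V - T. f w u \<noteq> f w v) T"

definition separated_triple :: "'a set \<Rightarrow> ('a \<Rightarrow> 'a \<Rightarrow> 'c) \<Rightarrow> bool" where
  "separated_triple V f \<longleftrightarrow> (\<exists>T. outer_separated V f T \<and> card T = 3)"

lemma outer_separatedE:
  assumes "outer_separated V f T" "u \<in> T" "v \<in> T" "u \<noteq> v"
  obtains w where "w \<in> V - T" "f w u \<noteq> f w v"
  using assms unfolding outer_separated_def pairwise_def by blast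

lemma outer_separated_subset:
  assumes "outer_separated V f T" "T' \<subseteq> T"
  shows "outer_separated V f T'"
  using assms unfolding outer_separated_def by (auto elim!: pairwise_mono)

lemma outer_separated_cong:
  assumes "\<And>u v w. \<lbrakk>u \<in> V; v \<in> V; w \<in> V; w \<noteq> u; w \<noteq> v\<rbrakk> \<Longrightarrow> f w u = f w v \<longleftrightarrow> g w u = g w v"
  shows "outer_separated V f T \<longleftrightarrow> outer_separated V g T"
proof -
  have "f w u = f w v \<longleftrightarrow> g w u = g w v" if "T \<subseteq> V" "u \<in> T" "v \<in> T" "w \<in> V - T" for u v w
    using that by (intro assms) auto
  then show ?thesis
    unfolding outer_separated_def pairwise_def by blast
qed

lemma separated_tripleI:
  assumes "{a, b, c} \<subseteq> V" "a \<noteq> b" "b \<noteq> c" "a \<noteq> c"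
    and "u \<in> V - {a, b, c}" "f u a \<noteq> f u b"
    and "v \<in> V - {a, b, c}" "f v b \<noteq> f v c"
    and "w \<in> V - {a, b, c}" "f w a \<noteq> f w c"
  shows "separated_triple V f"
proof -
  have "pairwise (\<lambda>p q. \<exists>m\<in>V - {a, b, c}. f m p \<noteq> f m q) {a, b, c}"
    unfolding pairwise_insert
    by (intro conjI ballI impI) (use assms(5-10) in \<open>force simp: pairwise_def\<close>)+
  then have "outer_separated V f {a, b, c}"
    using assms(1) by (simp add: outer_separated_def)
  moreover have "card {a, b, c} = 3"
    using assms(2-4) by simp
  ultimately show ?thesis
    unfolding separated_triple_def by blast
qed

section \<open>Single and mutual arcs\<close>

definition adj_type :: "('a \<Rightarrow> 'a \<Rightarrow> bool) \<Rightarrow> 'a \<Rightarrow> 'a \<Rightarrow> bool \<times> bool" where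
  "adj_type E x y = (E x y, E y x)"

definition mutual_arc :: "('a \<Rightarrow> 'a \<Rightarrow> bool) \<Rightarrow> 'a \<Rightarrow> 'a \<Rightarrow> bool" where
  "mutual_arc E x y \<longleftrightarrow> E x y \<and> E y x"

definition single_arc :: "('a \<Rightarrow> 'a \<Rightarrow> bool) \<Rightarrow> 'a \<Rightarrow> 'a \<Rightarrow> bool" where
  "single_arc E x y \<longleftrightarrow> E x y \<and> \<not> E y x"

lemmas arc_defs = adj_type_def mutual_arc_def single_arc_def

lemma adj_type_conversep_eq_iff [simp]:
  "adj_type E\<inverse>\<inverse> x y = adj_type E\<inverse>\<inverse> x z \<longleftrightarrow> adj_type E x y = adj_type E x z"
  by (auto simp: adj_type_def)

lemma mutual_arc_conversep [simp]: "mutual_arc E\<inverse>\<inverse> x y \<longleftrightarrow> mutual_arc E x y"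
  by (auto simp: mutual_arc_def)

lemma single_arc_conversep [simp]: "single_arc E\<inverse>\<inverse> x y \<longleftrightarrow> single_arc E y x"
  by (simp add: single_arc_def)

section \<open>The extremal relations\<close>

definition complete_on :: "('a \<Rightarrow> 'a \<Rightarrow> bool) \<Rightarrow> 'a set \<Rightarrow> bool" where
  "complete_on E A \<longleftrightarrow> (\<forall>x\<in>A. \<forall>y\<in>A. E x y \<longleftrightarrow> x \<noteq> y)"

definition independent_on :: "('a \<Rightarrow> 'a \<Rightarrow> bool) \<Rightarrow> 'a set \<Rightarrow> bool" where
  "independent_on E A \<longleftrightarrow> (\<forall>x\<in>A. \<forall>y\<in>A. \<not> E x y)"

definition tripartition :: "'a set \<Rightarrow> 'a set \<Rightarrow> 'a set \<Rightarrow> 'a set \<Rightarrow> bool" where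
  "tripartition V A B C \<longleftrightarrow>
     V = A \<union> B \<union> C \<and> A \<inter> B = {} \<and> B \<inter> C = {} \<and> A \<inter> C = {} \<and> A \<noteq> {} \<and> B \<noteq> {} \<and> C \<noteq> {}"

definition lex_partition ::
    "nat pair_pre_digraph \<Rightarrow> ('a \<Rightarrow> 'a \<Rightarrow> bool) \<Rightarrow> 'a set \<Rightarrow> 'a set \<Rightarrow> 'a set \<Rightarrow> 'a set \<Rightarrow> bool" where
  "lex_partition Q E V A B C \<longleftrightarrow>
     tripartition V A B C \<and>
     (\<forall>x\<in>A. \<forall>y\<in>B. adj_type E x y = ((0, 1) \<in> parcs Q, (1, 0) \<in> parcs Q)) \<and>
     (\<forall>x\<in>B. \<forall>y\<in>C. adj_type E x y = ((1, 2) \<in> parcs Q, (2, 1) \<in> parcs Q)) \<and>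
     (\<forall>x\<in>C. \<forall>y\<in>A. adj_type E x y = ((2, 0) \<in> parcs Q, (0, 2) \<in> parcs Q))"

lemma lex_partition_G1_iff:
  "lex_partition G1_digraph E V A B C \<longleftrightarrow>
     tripartition V A B C \<and>
     (\<forall>x\<in>A. \<forall>y\<in>B. single_arc E x y) \<and> (\<forall>x\<in>B. \<forall>y\<in>C. mutual_arc E x y) \<and>
     (\<forall>x\<in>C. \<forall>y\<in>A. single_arc E x y)"
  by (simp add: lex_partition_def G1_digraph_def arc_defs)

lemma lex_partition_G2_iff:
  "lex_partition G2_digraph E V A B C \<longleftrightarrow>
     tripartition V A B C \<and>
     (\<forall>x\<in>A. \<forall>y\<in>B. mutual_arc E x y) \<and> (\<forall>x\<in>B. \<forall>y\<in>C. mutual_arc E x y) \<and>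
     (\<forall>x\<in>C. \<forall>y\<in>A. single_arc E x y)"
  by (simp add: lex_partition_def G2_digraph_def arc_defs)

inductive extremal :: "('a \<Rightarrow> 'a \<Rightarrow> bool) \<Rightarrow> 'a set \<Rightarrow> bool" for E V where
  P2: "\<lbrakk>lex_partition G2_digraph E V {p} {a, b} {q}; single_arc E a b\<rbrakk> \<Longrightarrow> extremal E V"
| G1: "\<lbrakk>lex_partition G1_digraph E V {z} B C; complete_on E B; complete_on E C\<rbrakk> \<Longrightarrow> extremal E V"
| G2_left:
    "\<lbrakk>lex_partition G2_digraph E V {z} B C; complete_on E B; complete_on E C\<rbrakk> \<Longrightarrow> extremal E V"
| G2_right:
    "\<lbrakk>lex_partition G2_digraph E V A B {z}; complete_on E A; complete_on E B\<rbrakk> \<Longrightarrow> extremal E V"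
| arcless: "\<lbrakk>lex_partition G2_digraph E V {p} B {q}; independent_on E B\<rbrakk> \<Longrightarrow> extremal E V"

lemma complete_on_conversep [simp]: "complete_on E\<inverse>\<inverse> A \<longleftrightarrow> complete_on E A"
  by (auto simp: complete_on_def)

lemma independent_on_conversep [simp]: "independent_on E\<inverse>\<inverse> A \<longleftrightarrow> independent_on E A"
  by (auto simp: independent_on_def)

lemma lex_partition_G1_conversep:
  "lex_partition G1_digraph E\<inverse>\<inverse> V A B C \<longleftrightarrow> lex_partition G1_digraph E V A C B"
  by (auto simp: lex_partition_G1_iff tripartition_def arc_defs)

lemma lex_partition_G2_conversep:
  "lex_partition G2_digraph E\<inverse>\<inverse> V A B C \<longleftrightarrow> lex_partition G2_digraph E V C B A"
  by (auto simp: lex_partition_G2_iff tripartition_def arc_defs)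

lemma extremal_of_conversep:
  assumes "extremal E\<inverse>\<inverse> V"
  shows "extremal E V"
  using assms
proof cases
  case (P2 p a b q)
  then show ?thesis
    by (intro extremal.P2[of E V q b a p]) (simp_all add: lex_partition_G2_conversep insert_commute)
qed (auto simp: lex_partition_G1_conversep lex_partition_G2_conversep intro: extremal.intros)

section \<open>Relations without a separated triple\<close>

locale loopless_relation =
  fixes V :: "'a set" and E :: "'a \<Rightarrow> 'a \<Rightarrow> bool"
  assumes E_in_V: "E x y \<Longrightarrow> x \<in> V \<and> y \<in> V"
    and E_irrefl: "\<not> E x x"
begin

lemma single_arcD: "single_arc E x y \<Longrightarrow> x \<in> V \<and> y \<in> V \<and> x \<noteq> y"
  using E_in_V[of x y] by (auto simp: single_arc_def)

end

locale unseparated_relation = loopless_relation +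
  assumes four_le_card: "4 \<le> card V"
    and two_step: "\<lbrakk>x \<in> V; y \<in> V; x \<noteq> y; \<not> E x y\<rbrakk> \<Longrightarrow> \<exists>m. E x m \<and> E m y"
    and not_separated_triple: "\<not> separated_triple V (adj_type E)"
begin

lemma unseparated_conversep: "unseparated_relation V E\<inverse>\<inverse>"
proof
  have "outer_separated V (adj_type E\<inverse>\<inverse>) T \<longleftrightarrow> outer_separated V (adj_type E) T" for T
    by (rule outer_separated_cong) simp
  then show "\<not> separated_triple V (adj_type E\<inverse>\<inverse>)"
    using not_separated_triple by (simp add: separated_triple_def)
  show "\<exists>m. E\<inverse>\<inverse> x m \<and> E\<inverse>\<inverse> m y" if "x \<in> V" "y \<in> V" "x \<noteq> y" "\<not> E\<inverse>\<inverse> x y" for x y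
    using two_step[of y x] that by auto
qed (use E_in_V E_irrefl four_le_card in auto)

lemma obtain_fourth_vertex:
  obtains w where "w \<in> V" "w \<notin> {x, y, z}"
proof -
  have "card {x, y, z} \<le> 3"
    by (simp add: card_insert_if)
  then have "\<not> V \<subseteq> {x, y, z}"
    using four_le_card card_mono[of "{x, y, z}" V] by auto
  then show thesis
    using that by auto
qed

lemma obtain_midpoint:
  assumes "x \<in> V" "y \<in> V" "x \<noteq> y" "\<not> E x y"
  obtains m where "E x m" "E m y" "m \<in> V" "m \<noteq> x" "m \<noteq> y"
  using two_step[OF assms] E_in_V E_irrefl by metis

lemma obtain_in_neighbour:
  assumes "x \<in> V"
  obtains u where "E u x"
proof -
  obtain y where "y \<in> V" "y \<noteq> x"
    using obtain_fourth_vertex[of x x x] by auto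
  then show thesis
    using two_step[of y x] assms that by blast
qed

lemma at_most_two_types:
  assumes "{a, b, c} \<subseteq> V - {w}"
  shows "adj_type E w a = adj_type E w b \<or> adj_type E w b = adj_type E w c \<or>
    adj_type E w a = adj_type E w c"
proof (rule ccontr)
  assume types: "\<not> ?thesis"
  have "w \<in> V"
    using types assms E_in_V by (auto simp: adj_type_def)
  then have w_outside: "w \<in> V - {a, b, c}"
    using assms by auto
  have "separated_triple V (adj_type E)"
    using types assms
    by (intro separated_tripleI[OF _ _ _ _ w_outside _ w_outside _ w_outside]) auto
  with not_separated_triple show False ..
qed

lemma same_type_unseparated:
  assumes "{x, x', y} \<subseteq> V - {z}" "z \<in> V" "adj_type E z x = adj_type E z x'"
    and "adj_type E z x \<noteq> adj_type E z y" "w \<in> V - {x, x', y}"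
  shows "adj_type E w x = adj_type E w x'"
proof (rule ccontr)
  assume "\<not> ?thesis"
  moreover have "z \<in> V - {x, x', y}"
    using assms(1,2) by auto
  ultimately have "separated_triple V (adj_type E)"
    using assms by (intro separated_tripleI[of x x' y V w _ z z]) auto
  with not_separated_triple show False ..
qed

lemma tail_types:
  assumes "single_arc E x y" "E u x" "v \<in> V" "v \<noteq> x"
  shows "adj_type E x v = adj_type E x y \<or> adj_type E x v = adj_type E x u"
proof -
  have "adj_type E x y \<noteq> adj_type E x u"
    using assms(1,2) by (auto simp: arc_defs)
  moreover have "{y, u, v} \<subseteq> V - {x}"
    using assms single_arcD[OF assms(1)] E_in_V[OF assms(2)] E_irrefl by auto
  ultimately show ?thesis
    using at_most_two_types[of y u v x] by auto
qed

lemma tail_adjacent: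
  assumes "single_arc E x y" "v \<in> V" "v \<noteq> x"
  shows "E x v \<or> E v x"
proof -
  obtain u where "E u x"
    using obtain_in_neighbour single_arcD[OF assms(1)] by blast
  then show ?thesis
    using tail_types[OF assms(1) _ assms(2,3)] assms(1) by (auto simp: arc_defs)
qed

lemma head_adjacent:
  assumes "single_arc E y x" "v \<in> V" "v \<noteq> x"
  shows "E x v \<or> E v x"
  using unseparated_relation.tail_adjacent[OF unseparated_conversep, of x y v] assms by auto

subsection \<open>A vertex with an outgoing and an incoming single arc\<close>

lemma through_vertex_single:
  assumes "single_arc E z x" "single_arc E y z" "v \<in> V" "v \<noteq> z"
  shows "single_arc E z v \<or> single_arc E v z"
  using tail_types[OF assms(1) _ assms(3,4), of y] assms(1,2) by (auto simp: arc_defs)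

lemma through_vertex_not_mutual:
  assumes "single_arc E z x" "single_arc E y z"
  shows "\<not> mutual_arc E z v"
  using through_vertex_single[OF assms, of v] E_in_V[of z v] E_irrefl by (auto simp: arc_defs)

lemma out_neighbours_unseparated:
  assumes "single_arc E z x" "single_arc E z x'" "single_arc E y z" "w \<in> V - {x, x', y}"
  shows "adj_type E w x = adj_type E w x'"
proof (rule same_type_unseparated)
  show "{x, x', y} \<subseteq> V - {z}" "z \<in> V"
    using assms single_arcD by blast+
  show "adj_type E z x = adj_type E z x'" "adj_type E z x \<noteq> adj_type E z y"
    using assms by (auto simp: arc_defs)
qed fact

lemma out_neighbour_reaches:
  assumes "single_arc E z x" "single_arc E y z"
  obtains y' where "single_arc E y' z" "E x y'"
proof -
  obtain m where midpoint: "E x m" "E m z" "m \<in> V" "m \<noteq> z"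
    using obtain_midpoint[of x z] single_arcD[OF assms(1)] assms(1) by (auto simp: single_arc_def)
  then have "single_arc E m z"
    using through_vertex_single[OF assms, of m] by (auto simp: single_arc_def)
  with midpoint that show thesis
    by blast
qed

lemma in_neighbour_reached:
  assumes "single_arc E z x" "single_arc E y z"
  obtains x' where "single_arc E z x'" "E x' y"
  using unseparated_relation.out_neighbour_reaches[OF unseparated_conversep, of z y x] assms by auto

lemma single_arc_between_out_neighbours:
  assumes "single_arc E z p" "single_arc E z q" "single_arc E y z" "single_arc E p q"
  shows "E y p"
proof -
  obtain m where midpoint: "E q m" "E m p" "m \<in> V" "m \<noteq> q" "m \<noteq> p"
    using obtain_midpoint[of q p] single_arcD[OF assms(4)] assms(4) by (auto simp: single_arc_def)
  have "\<not> mutual_arc E p m"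
    by (rule through_vertex_not_mutual[OF assms(4,1)])
  then have "adj_type E m p \<noteq> adj_type E m q"
    using midpoint by (auto simp: arc_defs)
  then have "m = y"
    using out_neighbours_unseparated[OF assms(1-3), of m] midpoint by blast
  with midpoint show ?thesis
    by simp
qed

lemma no_single_arc_between_out_neighbours:
  assumes "single_arc E z p" "single_arc E z q" "single_arc E y z"
  shows "\<not> single_arc E p q"
proof
  assume arc: "single_arc E p q"
  obtain y' where y': "single_arc E y' z" "E p y'"
    using out_neighbour_reaches assms(1,3) .
  then have "mutual_arc E p y'"
    using single_arc_between_out_neighbours[OF assms(1,2) y'(1) arc] by (simp add: mutual_arc_def)
  moreover have "\<not> mutual_arc E p y'"
    by (rule through_vertex_not_mutual[OF arc assms(1)])
  ultimately show False
    by simp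
qed

lemma out_neighbours_mutual:
  assumes "single_arc E z p" "single_arc E z q" "single_arc E y z" "p \<noteq> q"
  shows "mutual_arc E p q"
proof -
  have "E p q \<or> E q p"
    using head_adjacent[OF assms(1), of q] single_arcD[OF assms(2)] assms(4) by blast
  then show ?thesis
    using no_single_arc_between_out_neighbours[OF assms(1-3)]
      no_single_arc_between_out_neighbours[OF assms(2,1,3)]
    by (auto simp: arc_defs)
qed

lemma in_neighbours_mutual:
  assumes "single_arc E p z" "single_arc E q z" "single_arc E z x" "p \<noteq> q"
  shows "mutual_arc E p q"
  using unseparated_relation.out_neighbours_mutual[OF unseparated_conversep, of z p q x] assms
  by simp

lemma not_single_arc_out_in:
  assumes zx: "single_arc E z x" and yz: "single_arc E y z"
  shows "\<not> single_arc E x y"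
proof
  assume xy: "single_arc E x y"
  obtain w where fourth: "w \<in> V" "w \<notin> {x, y, z}"
    by (rule obtain_fourth_vertex)
  then consider "single_arc E z w" | "single_arc E w z"
    using through_vertex_single[OF zx yz, of w] by blast
  then have "mutual_arc E x w \<or> mutual_arc E y w"
    using out_neighbours_mutual[OF zx _ yz, of w] in_neighbours_mutual[OF yz _ zx, of w] fourth
    by cases auto
  then show False
    using through_vertex_not_mutual[OF xy zx, of w] through_vertex_not_mutual[OF yz xy, of w]
    by blast
qed

lemma not_single_arc_in_out:
  assumes zx: "single_arc E z x" and yz: "single_arc E y z"
  shows "\<not> single_arc E y x"
proof
  assume yx: "single_arc E y x"
  obtain y' where y': "single_arc E y' z" "E x y'"
    using out_neighbour_reaches zx yz .
  obtain x' where x': "single_arc E z x'" "E x' y"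
    using in_neighbour_reached zx yz .
  have "x \<in> V - {y, y', x'}"
    using single_arcD[OF yx] yx x' y' E_irrefl by (auto simp: single_arc_def)
  then have "adj_type E x y = adj_type E x y'"
    using unseparated_relation.out_neighbours_unseparated
        [OF unseparated_conversep, of z y y' x' x] yz y'(1) x'(1)
    by simp
  then show False
    using yx y'(2) by (simp add: arc_defs)
qed

lemma out_in_neighbours_mutual:
  assumes "single_arc E z x" "single_arc E y z"
  shows "mutual_arc E x y"
proof -
  have "x \<noteq> y"
    using assms by (auto simp: single_arc_def)
  then have "E x y \<or> E y x"
    using head_adjacent[OF assms(1), of y] single_arcD[OF assms(2)] by blast
  then show ?thesis
    using not_single_arc_out_in[OF assms] not_single_arc_in_out[OF assms] by (auto simp: arc_defs)
qed

lemma through_vertex_extremal: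
  assumes zx: "single_arc E z x" and yz: "single_arc E y z"
  shows "extremal E V"
proof -
  define B where "B = {u. single_arc E z u}"
  define C where "C = {u. single_arc E u z}"
  have "V = {z} \<union> B \<union> C"
    using through_vertex_single[OF assms] single_arcD assms unfolding B_def C_def by blast
  then have "lex_partition G1_digraph E V {z} B C"
    using assms out_in_neighbours_mutual single_arcD
    unfolding lex_partition_G1_iff tripartition_def by (auto simp: B_def C_def single_arc_def)
  moreover have "complete_on E B"
    using out_neighbours_mutual[OF _ _ yz] E_irrefl
    by (auto simp: complete_on_def B_def mutual_arc_def)
  moreover have "complete_on E C"
    using in_neighbours_mutual[OF _ _ zx] E_irrefl
    by (auto simp: complete_on_def C_def mutual_arc_def)
  ultimately show ?thesis
    by (rule extremal.G1)
qed

end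

subsection \<open>No vertex has both an outgoing and an incoming single arc\<close>

definition tails :: "('a \<Rightarrow> 'a \<Rightarrow> bool) \<Rightarrow> 'a set" where
  "tails E = {x. \<exists>y. single_arc E x y}"

definition heads :: "('a \<Rightarrow> 'a \<Rightarrow> bool) \<Rightarrow> 'a set" where
  "heads E = {y. \<exists>x. single_arc E x y}"

definition unoriented :: "'a set \<Rightarrow> ('a \<Rightarrow> 'a \<Rightarrow> bool) \<Rightarrow> 'a set" where
  "unoriented V E = V - tails E - heads E"

lemma tails_conversep [simp]: "tails E\<inverse>\<inverse> = heads E"
  and heads_conversep [simp]: "heads E\<inverse>\<inverse> = tails E"
  by (simp_all add: tails_def heads_def)

lemma single_arc_tail: "single_arc E x y \<Longrightarrow> x \<in> tails E"
  and single_arc_head: "single_arc E x y \<Longrightarrow> y \<in> heads E"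
  by (auto simp: tails_def heads_def)

locale split_relation = unseparated_relation +
  assumes tails_heads_disjoint: "tails E \<inter> heads E = {}"
begin

lemma split_conversep: "split_relation V E\<inverse>\<inverse>"
  by (intro split_relation.intro unseparated_conversep split_relation_axioms.intro)
    (use tails_heads_disjoint in auto)

lemma V_eq: "V = tails E \<union> heads E \<union> unoriented V E"
  using single_arcD by (auto simp: unoriented_def tails_def heads_def)

lemma tail_mutual:
  assumes "s \<in> tails E" "v \<in> V" "v \<noteq> s" "\<not> single_arc E s v"
  shows "mutual_arc E s v"
proof -
  obtain y where y: "single_arc E s y"
    using assms(1) by (auto simp: tails_def)
  have "\<not> single_arc E v s"
    using assms(1) single_arc_head[of E v s] tails_heads_disjoint by blast
  then show ?thesis
    using tail_adjacent[OF y assms(2,3)] assms(4) by (auto simp: arc_defs)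
qed

lemma head_mutual:
  assumes "r \<in> heads E" "v \<in> V" "v \<noteq> r" "\<not> single_arc E v r"
  shows "mutual_arc E r v"
  using split_relation.tail_mutual[OF split_conversep, of r v] assms by simp

lemma tails_mutual:
  assumes "s \<in> tails E" "s' \<in> tails E" "s \<noteq> s'"
  shows "mutual_arc E s s'"
proof (rule tail_mutual)
  show "s' \<in> V"
    using assms(2) V_eq by blast
  show "\<not> single_arc E s s'"
    using assms(2) single_arc_head[of E s s'] tails_heads_disjoint by blast
qed (use assms in auto)

lemma heads_mutual:
  assumes "r \<in> heads E" "r' \<in> heads E" "r \<noteq> r'"
  shows "mutual_arc E r r'"
  using split_relation.tails_mutual[OF split_conversep, of r r'] assms by simp

lemma tail_unoriented_mutual:
  assumes "s \<in> tails E" "c \<in> unoriented V E"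
  shows "mutual_arc E s c"
  using assms single_arc_head[of E s c]
  by (intro tail_mutual) (auto simp: unoriented_def)

lemma head_unoriented_mutual:
  assumes "r \<in> heads E" "c \<in> unoriented V E"
  shows "mutual_arc E r c"
  using assms single_arc_tail[of E c r]
  by (intro head_mutual) (auto simp: unoriented_def)

lemma unoriented_sym:
  assumes "c \<in> unoriented V E" "c' \<in> unoriented V E"
  shows "E c c' \<longleftrightarrow> E c' c"
  using assms single_arc_tail[of E c c'] single_arc_tail[of E c' c]
  by (auto simp: unoriented_def single_arc_def)

lemma single_arc_completes_square:
  assumes "single_arc E s r" "single_arc E s' r'" "s \<noteq> s'" "r \<noteq> r'" "single_arc E s r'"
  shows "single_arc E s' r"
proof -
  have vertices: "s \<in> V" "s' \<in> V" "r \<in> V" "r' \<in> V" "r' \<noteq> s" "r' \<noteq> s'"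
    using assms(2,5) single_arcD assms(1) by blast+
  obtain m where midpoint: "E r' m" "E m s" "m \<in> V" "m \<noteq> r'" "m \<noteq> s"
    using obtain_midpoint[of r' s] vertices assms(5) by (auto simp: single_arc_def)
  then have "m \<noteq> r" "m \<noteq> s'"
    using assms(1,2) by (auto simp: single_arc_def)
  have "adj_type E s' r = adj_type E s' r'"
  proof (rule same_type_unseparated)
    show "{r, r', m} \<subseteq> V - {s}"
      using vertices midpoint single_arcD[OF assms(1)] by auto
    show "adj_type E s r = adj_type E s r'" "adj_type E s r \<noteq> adj_type E s m"
      using assms(1,5) midpoint(2) by (auto simp: arc_defs)
    show "s' \<in> V - {r, r', m}"
      using vertices \<open>m \<noteq> s'\<close> assms(1) single_arc_head[of E s r] single_arc_tail[OF assms(2)]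
        tails_heads_disjoint by blast
  qed (use vertices in simp)
  then show ?thesis
    using assms(2) by (simp add: arc_defs)
qed

lemma mutual_with_tail_not_tail:
  assumes ms: "mutual_arc E m s" and mr: "mutual_arc E m r" and "s \<in> tails E"
    and s'r: "single_arc E s' r" and "s \<noteq> s'"
  shows "m \<notin> tails E"
proof
  assume "m \<in> tails E"
  then obtain t where mt: "single_arc E m t"
    by (auto simp: tails_def)
  have ss': "mutual_arc E s s'"
    using tails_mutual assms single_arc_tail by metis
  have "t \<noteq> s'"
    using single_arc_head[OF mt] single_arc_tail[OF s'r] tails_heads_disjoint by blast
  have "adj_type E s' s = adj_type E s' r"
  proof (rule same_type_unseparated)
    show "adj_type E m s = adj_type E m r" "adj_type E m s \<noteq> adj_type E m t"
      using ms mr mt by (auto simp: arc_defs)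
    have "{m, s, r, t, s'} \<subseteq> V" "m \<noteq> s" "m \<noteq> r"
      using ms mr E_in_V E_irrefl single_arcD[OF mt] single_arcD[OF s'r] unfolding mutual_arc_def
      by auto
    then show "{s, r, t} \<subseteq> V - {m}" "m \<in> V" "s' \<in> V - {s, r, t}"
      using single_arcD[OF mt] single_arcD[OF s'r] \<open>t \<noteq> s'\<close> \<open>s \<noteq> s'\<close> by auto
  qed
  then show False
    using ss' s'r by (auto simp: arc_defs)
qed

lemma mutual_with_head_not_head:
  assumes "mutual_arc E m r" "mutual_arc E m s" "r \<in> heads E" "single_arc E s r'" "r \<noteq> r'"
  shows "m \<notin> heads E"
  using split_relation.mutual_with_tail_not_tail[OF split_conversep, of m r s r'] assms by simp

lemma no_single_arc_square:
  assumes "single_arc E s r" "single_arc E s r'" "single_arc E s' r" "single_arc E s' r'"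
    and "s \<noteq> s'" "r \<noteq> r'"
  shows False
proof -
  have tails: "s \<in> tails E" "s' \<in> tails E" and heads: "r \<in> heads E" "r' \<in> heads E"
    using assms single_arc_tail single_arc_head by metis+
  have vertices: "s \<in> V" "s' \<in> V" "r \<in> V" "r' \<in> V"
    and distinct: "r \<noteq> s" "r \<noteq> s'" "r' \<noteq> s" "r' \<noteq> s'"
    using tails heads V_eq tails_heads_disjoint by blast+
  obtain m where midpoint: "E r m" "E m s" "m \<in> V" "m \<noteq> r" "m \<noteq> s"
    using obtain_midpoint[of r s] vertices assms(1) by (auto simp: single_arc_def)
  then have ms: "mutual_arc E m s" and mr: "mutual_arc E m r"
    using tail_mutual[OF tails(1), of m] head_mutual[OF heads(1), of m] by (auto simp: arc_defs)
  then have "m \<notin> tails E" "m \<notin> heads E"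
    using mutual_with_tail_not_tail[OF ms mr tails(1) assms(3,5)]
      mutual_with_head_not_head[OF mr ms heads(1) assms(2,6)] by blast+
  then have "m \<in> unoriented V E" and "m \<noteq> s'" "m \<noteq> r'"
    using midpoint(3) tails heads by (auto simp: unoriented_def)
  then have "mutual_arc E s' m" "mutual_arc E r' m"
    using tails heads tail_unoriented_mutual head_unoriented_mutual by blast+
  moreover have "mutual_arc E s' s" "mutual_arc E r' r"
    using tails_mutual tails heads_mutual heads assms(5,6) by metis+
  ultimately have "separated_triple V (adj_type E)"
    using vertices distinct midpoint assms \<open>m \<noteq> s'\<close> \<open>m \<noteq> r'\<close>
    by (intro separated_tripleI[of s r m V s' _ s' r']) (auto simp: arc_defs)
  with not_separated_triple show False ..
qed

lemma disjoint_single_arcs_mutual: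
  assumes "single_arc E s r" "single_arc E s' r'" "s \<noteq> s'" "r \<noteq> r'"
  shows "mutual_arc E s r'"
proof (rule tail_mutual)
  show "s \<in> tails E"
    by (rule single_arc_tail) fact
  show "r' \<in> V"
    using single_arcD[OF assms(2)] by blast
  show "r' \<noteq> s"
    using single_arc_tail[OF assms(1)] single_arc_head[OF assms(2)] tails_heads_disjoint by blast
  show "\<not> single_arc E s r'"
    using single_arc_completes_square[OF assms] no_single_arc_square[OF assms(1) _ _ assms(2-4)]
    by blast
qed

lemma disjoint_single_arcs_third_tail:
  assumes arcs: "single_arc E s r" "single_arc E s' r'" "s \<noteq> s'" "r \<noteq> r'"
    and third: "w \<in> V" "w \<notin> heads E" "w \<notin> {s, s'}"
  shows "single_arc E w r'"
proof -
  have tails: "s \<in> tails E" "s' \<in> tails E" and heads: "r \<in> heads E" "r' \<in> heads E"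
    using arcs single_arc_tail single_arc_head by metis+
  have sw: "mutual_arc E s w"
    using tail_mutual[OF tails(1) third(1)] single_arc_head[of E s w] third by blast
  have ss': "mutual_arc E s s'"
    by (rule tails_mutual[OF tails arcs(3)])
  have "adj_type E r' w = adj_type E r' s'"
  proof (rule same_type_unseparated)
    show "{w, s', r} \<subseteq> V - {s}" "s \<in> V" "r' \<in> V - {w, s', r}"
      using third arcs(3,4) single_arcD[OF arcs(1)] single_arcD[OF arcs(2)] heads by auto
    show "adj_type E s w = adj_type E s s'" "adj_type E s w \<noteq> adj_type E s r"
      using sw ss' arcs(1) by (auto simp: arc_defs)
  qed
  then show ?thesis
    using arcs(2) by (simp add: arc_defs)
qed

lemma disjoint_single_arcs_span_non_heads:
  assumes arcs: "single_arc E s r" "single_arc E s' r'" "s \<noteq> s'" "r \<noteq> r'"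
    and non_head: "w \<in> V" "w \<notin> heads E"
  shows "w \<in> {s, s'}"
proof (rule ccontr)
  assume new: "w \<notin> {s, s'}"
  then have "single_arc E w r" "single_arc E w r'"
    using disjoint_single_arcs_third_tail[of s' r' s r w]
      disjoint_single_arcs_third_tail[OF arcs non_head] arcs non_head by auto
  moreover have "mutual_arc E w r"
    using disjoint_single_arcs_mutual[of w r' s r] calculation(2) arcs new by blast
  ultimately show False
    by (simp add: arc_defs)
qed

lemma disjoint_single_arcs_extremal:
  assumes arcs: "single_arc E s r" "single_arc E s' r'" "s \<noteq> s'" "r \<noteq> r'"
  shows "extremal E V"
proof (rule extremal.P2)
  have tails: "s \<in> tails E" "s' \<in> tails E" and heads: "r \<in> heads E" "r' \<in> heads E"
    using arcs single_arc_tail single_arc_head by metis+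
  have "w \<in> {s, s'} \<or> w \<in> {r, r'}" if "w \<in> V" for w
  proof (cases "w \<in> heads E")
    case False
    then show ?thesis
      using disjoint_single_arcs_span_non_heads[OF arcs that] by blast
  next
    case True
    then have "w \<notin> heads E\<inverse>\<inverse>"
      using tails_heads_disjoint by auto
    then show ?thesis
      using split_relation.disjoint_single_arcs_span_non_heads
        [OF split_conversep, of r s r' s' w] arcs that by simp
  qed
  then have "V = {s, s', r, r'}"
    using single_arcD[OF arcs(1)] single_arcD[OF arcs(2)] by blast
  moreover have "mutual_arc E s s'" "mutual_arc E r r'" "mutual_arc E s r'" "mutual_arc E s' r"
    using tails_mutual[OF tails] heads_mutual[OF heads] disjoint_single_arcs_mutual[OF arcs]
      disjoint_single_arcs_mutual[OF arcs(2,1)] arcs(3,4) by auto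
  moreover have "{s, s'} \<inter> {r, r'} = {}"
    using tails heads tails_heads_disjoint by blast
  ultimately show "lex_partition G2_digraph E V {r} {s', r'} {s}"
    using arcs by (auto simp: lex_partition_G2_iff tripartition_def arc_defs)
qed (fact arcs(2))

lemma unique_head_lex_partition:
  assumes heads: "heads E = {r}"
  shows "lex_partition G2_digraph E V {r} (unoriented V E) (tails E)"
proof -
  have tail_arc: "single_arc E s r" if "s \<in> tails E" for s
    using that heads single_arc_head[of E s] by (auto simp: tails_def)
  obtain s where arc: "single_arc E s r"
    using heads by (auto simp: heads_def)
  obtain m where "E r m" "E m s" "m \<in> V" "m \<noteq> r"
    using obtain_midpoint[of r s] single_arcD[OF arc] arc by (auto simp: single_arc_def)
  then have "m \<in> unoriented V E"
    using tail_arc[of m] heads by (auto simp: unoriented_def single_arc_def)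
  moreover have "mutual_arc E r c" "mutual_arc E c s" if "c \<in> unoriented V E" "s \<in> tails E" for c s
    using that head_unoriented_mutual[of r c] tail_unoriented_mutual[of s c] heads
    by (auto simp: mutual_arc_def)
  ultimately show ?thesis
    unfolding lex_partition_G2_iff tripartition_def
    using V_eq heads tails_heads_disjoint tail_arc single_arc_tail[OF arc]
    by (auto simp: unoriented_def)
qed

lemma unique_head_unoriented_uniform:
  assumes heads: "heads E = {r}"
    and unoriented: "c \<in> unoriented V E" "p \<in> unoriented V E" "q \<in> unoriented V E"
    and "c \<noteq> p" "c \<noteq> q"
  shows "E c p \<longleftrightarrow> E c q"
proof -
  obtain s where arc: "single_arc E s r"
    using heads by (auto simp: heads_def)
  have "adj_type E c p = adj_type E c q"
  proof (rule same_type_unseparated)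
    show "{p, q, s} \<subseteq> V - {r}" "r \<in> V" "c \<in> V - {p, q, s}"
      using unoriented assms(5,6) heads single_arcD[OF arc] single_arc_tail[OF arc]
      by (auto simp: unoriented_def)
    show "adj_type E r p = adj_type E r q" "adj_type E r p \<noteq> adj_type E r s"
      using head_unoriented_mutual[of r p] head_unoriented_mutual[of r q] arc unoriented heads
      by (auto simp: arc_defs)
  qed
  then show ?thesis
    by (simp add: adj_type_def)
qed

lemma unique_head_unoriented_complete_or_independent:
  assumes heads: "heads E = {r}"
  shows "complete_on E (unoriented V E) \<or> independent_on E (unoriented V E)"
proof (rule disjCI)
  let ?C = "unoriented V E"
  assume "\<not> independent_on E ?C"
  then obtain u v where arc: "u \<in> ?C" "v \<in> ?C" "E u v"
    by (auto simp: independent_on_def)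
  note uniform = unique_head_unoriented_uniform[OF heads]
  have "E x y" if pair: "x \<in> ?C" "y \<in> ?C" "x \<noteq> y" for x y
  proof (cases "x = u")
    case True
    then show ?thesis
      using uniform[OF pair(1) arc(2) pair(2)] arc pair E_irrefl by blast
  next
    case False
    then have "E u x"
      using uniform[OF arc(1) arc(2) pair(1)] arc E_irrefl by blast
    then show ?thesis
      using uniform[OF pair(1) arc(1) pair(2)] unoriented_sym[OF arc(1) pair(1)] False pair(3)
      by blast
  qed
  then show "complete_on E ?C"
    using E_irrefl by (auto simp: complete_on_def)
qed

lemma unique_head_nonadjacent_imp_unique_tail:
  assumes heads: "heads E = {r}"
    and nonadjacent: "a \<in> unoriented V E" "b \<in> unoriented V E" "a \<noteq> b" "\<not> E a b"
    and tails: "s \<in> tails E" "s' \<in> tails E"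
  shows "s = s'"
proof (rule ccontr)
  assume "s \<noteq> s'"
  have sr: "single_arc E s' r"
    using tails(2) heads single_arc_head[of E s'] by (auto simp: tails_def)
  have "adj_type E s' s = adj_type E s' r"
  proof (rule same_type_unseparated)
    show "{s, r, b} \<subseteq> V - {a}" "a \<in> V" "s' \<in> V - {s, r, b}"
      using nonadjacent tails heads V_eq tails_heads_disjoint \<open>s \<noteq> s'\<close>
      by (auto simp: unoriented_def)
    show "adj_type E a s = adj_type E a r" "adj_type E a s \<noteq> adj_type E a b"
      using tail_unoriented_mutual[OF tails(1) nonadjacent(1)] head_unoriented_mutual[of r a]
        heads nonadjacent
      by (auto simp: arc_defs)
  qed
  then show False
    using tails_mutual[OF tails \<open>s \<noteq> s'\<close>] sr by (simp add: arc_defs)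
qed

lemma unique_head_extremal:
  assumes heads: "heads E = {r}"
  shows "extremal E V"
proof (cases "complete_on E (unoriented V E)")
  case True
  have "complete_on E (tails E)"
    using tails_mutual E_irrefl by (auto simp: complete_on_def mutual_arc_def)
  with True show ?thesis
    by (intro extremal.G2_left[OF unique_head_lex_partition[OF heads]])
next
  case False
  then obtain a b where nonadjacent: "a \<in> unoriented V E" "b \<in> unoriented V E" "a \<noteq> b" "\<not> E a b"
    using E_irrefl by (auto simp: complete_on_def)
  obtain s where "s \<in> tails E"
    using heads single_arc_tail by (fastforce simp: heads_def)
  then have "tails E = {s}"
    using unique_head_nonadjacent_imp_unique_tail[OF heads nonadjacent] by blast
  then show ?thesis
    using unique_head_lex_partition[OF heads] False
      unique_head_unoriented_complete_or_independent[OF heads]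
    by (intro extremal.arcless[of E V r "unoriented V E" s]) auto
qed

lemma single_arcs_cases:
  assumes arc: "single_arc E x y"
  obtains (head) r where "heads E = {r}" | (tail) s where "tails E = {s}"
    | (disjoint) s r s' r' where "single_arc E s r" "single_arc E s' r'" "s \<noteq> s'" "r \<noteq> r'"
proof (cases "heads E = {y} \<or> tails E = {x}")
  case True
  then show thesis
    using head tail by blast
next
  case False
  then obtain s r s' r' where "single_arc E s r" "s \<noteq> x" "single_arc E s' r'" "r' \<noteq> y"
    using arc by (auto simp: heads_def tails_def)
  then show thesis
    using disjoint[of x y s r] disjoint[of x y s' r'] disjoint[of s y x r'] arc by blast
qed

end

theorem (in unseparated_relation) unseparated_imp_extremal:
  assumes "single_arc E x y"
  shows "extremal E V"
proof (cases "tails E \<inter> heads E = {}")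
  case False
  then obtain z u v where "single_arc E z u" "single_arc E v z"
    by (auto simp: tails_def heads_def)
  then show ?thesis
    by (rule through_vertex_extremal)
next
  case True
  then interpret split_relation V E
    by unfold_locales
  from assms show ?thesis
  proof (cases rule: single_arcs_cases)
    case (head r)
    then show ?thesis
      by (rule unique_head_extremal)
  next
    case (tail s)
    then have "extremal E\<inverse>\<inverse> V"
      by (intro split_relation.unique_head_extremal[OF split_conversep]) simp
    then show ?thesis
      by (rule extremal_of_conversep)
  next
    case (disjoint s r s' r')
    then show ?thesis
      by (rule disjoint_single_arcs_extremal)
  qed
qed

section \<open>Extremal relations are unseparated\<close>

definition homogeneous_on :: "('a \<Rightarrow> 'a \<Rightarrow> bool) \<Rightarrow> 'a set \<Rightarrow> bool" where
  "homogeneous_on E A \<longleftrightarrow> (\<forall>w\<in>A. \<forall>u\<in>A - {w}. \<forall>v\<in>A - {w}. adj_type E w u = adj_type E w v)"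

lemma complete_on_imp_homogeneous_on: "complete_on E A \<Longrightarrow> homogeneous_on E A"
  and independent_on_imp_homogeneous_on: "independent_on E A \<Longrightarrow> homogeneous_on E A"
  by (auto simp: complete_on_def independent_on_def homogeneous_on_def adj_type_def)

lemma doubleton_homogeneous_on: "homogeneous_on E {a, b}"
  by (auto simp: homogeneous_on_def)

lemma lex_partition_part_unseparated:
  assumes "lex_partition Q E V A B C" "X \<in> {A, B, C}" "homogeneous_on E X"
    and "u \<in> X" "v \<in> X" "w \<in> V" "w \<noteq> u" "w \<noteq> v"
  shows "adj_type E w u = adj_type E w v"
proof (cases "w \<in> X")
  case True
  then show ?thesis
    using assms(3-8) by (simp add: homogeneous_on_def)
next
  case False
  have "V = A \<union> B \<union> C"
    and "\<And>x y. \<lbrakk>x \<in> A; y \<in> B\<rbrakk> \<Longrightarrow> (E x y \<longleftrightarrow> (0, 1) \<in> parcs Q) \<and> (E y x \<longleftrightarrow> (1, 0) \<in> parcs Q)"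
    and "\<And>x y. \<lbrakk>x \<in> B; y \<in> C\<rbrakk> \<Longrightarrow> (E x y \<longleftrightarrow> (1, 2) \<in> parcs Q) \<and> (E y x \<longleftrightarrow> (2, 1) \<in> parcs Q)"
    and "\<And>x y. \<lbrakk>x \<in> C; y \<in> A\<rbrakk> \<Longrightarrow> (E x y \<longleftrightarrow> (2, 0) \<in> parcs Q) \<and> (E y x \<longleftrightarrow> (0, 2) \<in> parcs Q)"
    using assms(1) by (simp_all add: lex_partition_def tripartition_def adj_type_def)
  then show ?thesis
    using False assms(2,4-6) by (auto simp: adj_type_def)
qed

lemma lex_partition_not_separated_triple:
  assumes partition: "lex_partition Q E V A B C"
    and homogeneous: "homogeneous_on E A" "homogeneous_on E B" "homogeneous_on E C"
    and transversal: "\<And>a b c. \<lbrakk>a \<in> A; b \<in> B; c \<in> C\<rbrakk> \<Longrightarrow> \<not> outer_separated V (adj_type E) {a, b, c}"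
  shows "\<not> separated_triple V (adj_type E)"
proof
  assume "separated_triple V (adj_type E)"
  then obtain T where triple: "outer_separated V (adj_type E) T" "card T = 3"
    by (auto simp: separated_triple_def)
  then have "finite T" "T \<subseteq> V"
    using card.infinite by (fastforce, simp add: outer_separated_def)
  have parts: "V = A \<union> B \<union> C" "A \<inter> B = {}" "B \<inter> C = {}" "A \<inter> C = {}"
    using partition by (simp_all add: lex_partition_def tripartition_def)
  have at_most_one: "card (T \<inter> X) \<le> 1" if part: "X \<in> {A, B, C}" for X
  proof -
    have "homogeneous_on E X"
      using part homogeneous by auto
    then have "u = v" if "u \<in> T \<inter> X" "v \<in> T \<inter> X" for u v
      using that lex_partition_part_unseparated[OF partition part, of u v]
        outer_separatedE[OF triple(1), of u v]
      by blast
    then show ?thesis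
      using \<open>finite T\<close> by (simp add: card_le_Suc0_iff_eq)
  qed
  have T_split: "T = T \<inter> A \<union> T \<inter> B \<union> T \<inter> C"
    using \<open>T \<subseteq> V\<close> parts(1) by blast
  have "card T = card (T \<inter> A) + card (T \<inter> B) + card (T \<inter> C)"
    using \<open>finite T\<close> parts(2-4)
    by (subst T_split) (subst card_Un_disjoint; auto simp: card_Un_disjoint)+
  then have "card (T \<inter> A) = 1" "card (T \<inter> B) = 1" "card (T \<inter> C) = 1"
    using triple(2) at_most_one[of A] at_most_one[of B] at_most_one[of C] by auto
  then obtain a b c where representatives: "T \<inter> A = {a}" "T \<inter> B = {b}" "T \<inter> C = {c}"
    by (auto simp: card_1_singleton_iff)
  then have "T = {a, b, c}"
    using T_split by blast
  then show False
    using triple(1) representatives transversal[of a b c] by blast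
qed

lemma not_outer_separatedI:
  assumes "u \<in> T" "v \<in> T" "u \<noteq> v" "\<And>w. w \<in> V - T \<Longrightarrow> f w u = f w v"
  shows "\<not> outer_separated V f T"
  using assms outer_separatedE by metis

context loopless_relation
begin

lemma complete_on_singleton: "complete_on E {z}"
  using E_irrefl by (simp add: complete_on_def)

lemma G2_singletons_not_separated_triple:
  assumes partition: "lex_partition G2_digraph E V {p} B {q}" and homogeneous: "homogeneous_on E B"
  shows "\<not> separated_triple V (adj_type E)"
proof (rule lex_partition_not_separated_triple[OF partition _ homogeneous])
  show "homogeneous_on E {p}" "homogeneous_on E {q}"
    by (simp_all add: homogeneous_on_def)
next
  fix a b c assume "a \<in> {p}" "b \<in> B" "c \<in> {q}"
  moreover have "adj_type E w p = adj_type E w q" if "w \<in> V - {p, b, q}" for w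
    using that partition by (auto simp: lex_partition_G2_iff tripartition_def arc_defs)
  moreover have "p \<noteq> q"
    using partition by (auto simp: lex_partition_G2_iff tripartition_def)
  ultimately show "\<not> outer_separated V (adj_type E) {a, b, c}"
    by (intro not_outer_separatedI[of p _ q]) auto
qed

lemma complete_parts_not_separated_triple:
  assumes partition: "lex_partition Q E V A B C"
    and complete: "complete_on E A" "complete_on E B" "complete_on E C"
    and joined: "A = {z} \<and> (\<forall>x\<in>B. \<forall>y\<in>C. mutual_arc E x y) \<or>
      C = {z} \<and> (\<forall>x\<in>A. \<forall>y\<in>B. mutual_arc E x y)"
  shows "\<not> separated_triple V (adj_type E)"
proof (rule lex_partition_not_separated_triple
    [OF partition complete[THEN complete_on_imp_homogeneous_on]])
  fix a b c assume members: "a \<in> A" "b \<in> B" "c \<in> C"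
  have parts: "V = A \<union> B \<union> C" "A \<inter> B = {}" "B \<inter> C = {}"
    using partition by (simp_all add: lex_partition_def tripartition_def)
  from joined show "\<not> outer_separated V (adj_type E) {a, b, c}"
  proof
    assume "A = {z} \<and> (\<forall>x\<in>B. \<forall>y\<in>C. mutual_arc E x y)"
    then have "adj_type E w b = adj_type E w c" if "w \<in> V - {a, b, c}" for w
      using that complete parts members by (auto simp: complete_on_def arc_defs)
    then show ?thesis
      using members parts by (intro not_outer_separatedI[of b _ c]) auto
  next
    assume "C = {z} \<and> (\<forall>x\<in>A. \<forall>y\<in>B. mutual_arc E x y)"
    then have "adj_type E w a = adj_type E w b" if "w \<in> V - {a, b, c}" for w
      using that complete parts members by (auto simp: complete_on_def arc_defs)
    then show ?thesis
      using members parts by (intro not_outer_separatedI[of a _ b]) auto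
  qed
qed

lemma extremal_not_separated_triple:
  assumes "extremal E V"
  shows "\<not> separated_triple V (adj_type E)"
  using assms
proof cases
  case (P2 p a b q)
  show ?thesis
    by (rule G2_singletons_not_separated_triple[OF P2(1) doubleton_homogeneous_on])
next
  case (G1 z B C)
  show ?thesis
    by (rule complete_parts_not_separated_triple
        [where z = z, OF G1(1) complete_on_singleton G1(2,3)])
      (use G1(1) in \<open>simp_all add: lex_partition_G1_iff tripartition_def\<close>)
next
  case (G2_left z B C)
  show ?thesis
    by (rule complete_parts_not_separated_triple
        [where z = z, OF G2_left(1) complete_on_singleton G2_left(2,3)])
      (use G2_left(1) in \<open>simp_all add: lex_partition_G2_iff tripartition_def\<close>)
next
  case (G2_right A B z)
  show ?thesis
    by (rule complete_parts_not_separated_triple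
        [where z = z, OF G2_right complete_on_singleton])
      (use G2_right(1) in \<open>simp_all add: lex_partition_G2_iff tripartition_def\<close>)
next
  case (arcless p B q)
  show ?thesis
    by (rule G2_singletons_not_separated_triple[OF arcless(1)
      independent_on_imp_homogeneous_on[OF arcless(2)]])
qed

lemma lex_partition_two_step:
  assumes partition: "lex_partition G1_digraph E V A B C \<or> lex_partition G2_digraph E V A B C"
    and A_complete: "complete_on E A" and nonadjacent: "x \<in> V" "y \<in> V" "x \<noteq> y" "\<not> E x y"
  shows "\<exists>m. E x m \<and> E m y"
proof -
  obtain b c where members: "b \<in> B" "c \<in> C"
    using partition by (auto simp: lex_partition_G1_iff lex_partition_G2_iff tripartition_def)
  have cover: "V = A \<union> B \<union> C" and arcs: "\<And>u v. \<lbrakk>u \<in> A; v \<in> B\<rbrakk> \<Longrightarrow> E u v"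
    "\<And>u v. \<lbrakk>u \<in> B; v \<in> C\<rbrakk> \<Longrightarrow> E u v \<and> E v u" "\<And>u v. \<lbrakk>u \<in> C; v \<in> A\<rbrakk> \<Longrightarrow> E u v"
    using partition
    by (elim disjE; simp add: lex_partition_G1_iff lex_partition_G2_iff tripartition_def arc_defs)+
  have not_A: "x \<notin> A \<or> y \<notin> A"
    using A_complete nonadjacent unfolding complete_on_def by blast
  show ?thesis
  proof (cases "x \<in> B")
    case True
    then have "y \<in> A \<union> B"
      using arcs(2)[of x y] nonadjacent cover by blast
    then have "E c y"
      using arcs(2)[of y c] arcs(3)[of c y] members by blast
    moreover have "E x c"
      using arcs(2)[of x c] True members by blast
    ultimately show ?thesis
      by blast
  next
    case False
    then have "y \<in> C"
      using arcs(1)[of x y] arcs(2)[of y x] arcs(3)[of x y] nonadjacent cover not_A by blast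
    then have "E b y"
      using arcs(2)[of b y] members by blast
    moreover have "E x b"
      using arcs(1)[of x b] arcs(2)[of b x] False members nonadjacent(1) cover by blast
    ultimately show ?thesis
      by blast
  qed
qed

lemma extremal_two_step:
  assumes "extremal E V" "x \<in> V" "y \<in> V" "x \<noteq> y" "\<not> E x y"
  shows "\<exists>m. E x m \<and> E m y"
proof -
  from assms(1) obtain A B C
    where "lex_partition G1_digraph E V A B C \<or> lex_partition G2_digraph E V A B C"
      and "complete_on E A"
    using complete_on_singleton by cases blast+
  then show ?thesis
    using assms(2-5) by (rule lex_partition_two_step)
qed

theorem unseparated_iff_extremal:
  assumes "4 \<le> card V" "single_arc E x y"
  shows "unseparated_relation V E \<longleftrightarrow> extremal E V"
proof
  assume "unseparated_relation V E"
  then show "extremal E V"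
    using assms(2) by (rule unseparated_relation.unseparated_imp_extremal)
next
  assume "extremal E V"
  then show "unseparated_relation V E"
    by unfold_locales
      (rule assms(1), rule extremal_two_step, assumption+, rule extremal_not_separated_triple)
qed

end

section \<open>Distances and the weak metric dimension\<close>

context wf_digraph
begin

lemma length_awalk_to_apath:
  assumes "awalk u p v"
  shows "length (awalk_to_apath p) \<le> length p"
  using assms
proof (induct rule: awalk_to_apath_induct)
  case (path p)
  then have "awalk_to_apath p = p"
    by (auto simp: awalk_to_apath.simps)
  then show ?case
    by simp
next
  case (decomp p q r s)
  then have "length (q @ s) \<le> length p"
    by (auto elim!: awalk_cyc_decompE)
  then show ?case
    using decomp step_awalk_to_apath[of _ p _ q r s] by auto
qed

lemma digraph_dist_le:
  assumes "awalk u p v"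
  shows "digraph_dist G u v \<le> length p"
proof -
  have "digraph_dist G u v \<le> length (awalk_to_apath p)"
    unfolding digraph_dist_def using apath_awalk_to_apath[OF assms] by (intro Least_le) blast
  then show ?thesis
    using length_awalk_to_apath[OF assms] by linarith
qed

lemma obtain_shortest_awalk:
  assumes "u \<rightarrow>\<^sup>* v"
  obtains p where "awalk u p v" "length p = digraph_dist G u v"
proof -
  have "\<exists>k p. apath u p v \<and> length p = k"
    using assms by (auto simp: reachable_apath)
  from LeastI_ex[OF this] show thesis
    using that unfolding digraph_dist_def by (auto intro: awalkI_apath)
qed

lemma digraph_dist_le_1:
  assumes "u \<rightarrow>\<^bsub>G\<^esub> v"
  shows "digraph_dist G u v \<le> 1"
proof -
  obtain e where "awalk u [e] v"
    using assms by (auto simp: arcs_ends_conv intro: arc_implies_awalk)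
  from digraph_dist_le[OF this] show ?thesis
    by simp
qed

lemma digraph_dist_triangle:
  assumes "u \<rightarrow>\<^sup>* v" "v \<rightarrow>\<^sup>* w"
  shows "digraph_dist G u w \<le> digraph_dist G u v + digraph_dist G v w"
proof -
  obtain p q where "awalk u p v" "length p = digraph_dist G u v"
    and "awalk v q w" "length q = digraph_dist G v w"
    using obtain_shortest_awalk assms by metis
  then show ?thesis
    using digraph_dist_le[of u "p @ q" w] by auto
qed

lemma digraph_dist_eq_0_iff:
  assumes "u \<rightarrow>\<^sup>* v"
  shows "digraph_dist G u v = 0 \<longleftrightarrow> u = v"
proof
  obtain p where walk: "awalk u p v" "length p = digraph_dist G u v"
    using obtain_shortest_awalk[OF assms] .
  then show "digraph_dist G u v = 0 \<Longrightarrow> u = v"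
    by (simp add: awalk_Nil_iff)
  show "u = v \<Longrightarrow> digraph_dist G u v = 0"
    using digraph_dist_le[of u "[]" u] walk(1) by (auto simp: awalk_Nil_iff)
qed

lemma digraph_dist_eq_1_iff:
  assumes "u \<rightarrow>\<^sup>* v" "u \<noteq> v"
  shows "digraph_dist G u v = 1 \<longleftrightarrow> u \<rightarrow>\<^bsub>G\<^esub> v"
proof
  assume "digraph_dist G u v = 1"
  then obtain p where "awalk u p v" "length p = 1"
    using obtain_shortest_awalk[OF assms(1)] by metis
  then obtain e where "awalk u [e] v"
    by (auto simp: length_Suc_conv)
  then show "u \<rightarrow>\<^bsub>G\<^esub> v"
    by (auto simp: awalk_simps arcs_ends_conv)
next
  assume "u \<rightarrow>\<^bsub>G\<^esub> v"
  then show "digraph_dist G u v = 1"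
    using digraph_dist_le_1[of u v] digraph_dist_eq_0_iff[OF assms(1)] assms(2) by linarith
qed

lemma obtain_vertex_on_geodesic:
  assumes "u \<rightarrow>\<^sup>* v" "i \<le> digraph_dist G u v"
  obtains x where "u \<rightarrow>\<^sup>* x" "x \<rightarrow>\<^sup>* v" "digraph_dist G u x = i"
    "digraph_dist G x v = digraph_dist G u v - i"
proof -
  obtain p where geodesic: "awalk u p v" "length p = digraph_dist G u v"
    using obtain_shortest_awalk[OF assms(1)] .
  have "awalk u (take i p @ drop i p) v"
    using geodesic by simp
  then obtain x where split: "awalk u (take i p) x" "awalk x (drop i p) v"
    unfolding awalk_append_iff by blast
  then have reach: "u \<rightarrow>\<^sup>* x" "x \<rightarrow>\<^sup>* v"
    by (auto intro: reachable_awalkI)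
  have "digraph_dist G u x \<le> i" "digraph_dist G x v \<le> digraph_dist G u v - i"
    using digraph_dist_le[OF split(1)] digraph_dist_le[OF split(2)] geodesic(2) assms(2) by auto
  moreover have "digraph_dist G u v \<le> digraph_dist G u x + digraph_dist G x v"
    by (rule digraph_dist_triangle[OF reach])
  ultimately show thesis
    using that[OF reach] assms(2) by linarith
qed

lemma digraph_dist_le_2_iff:
  assumes "u \<rightarrow>\<^sup>* v" "u \<noteq> v"
  shows "digraph_dist G u v \<le> 2 \<longleftrightarrow> u \<rightarrow>\<^bsub>G\<^esub> v \<or> (\<exists>m. u \<rightarrow>\<^bsub>G\<^esub> m \<and> m \<rightarrow>\<^bsub>G\<^esub> v)"
proof
  assume "digraph_dist G u v \<le> 2"
  moreover have "digraph_dist G u v \<noteq> 0"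
    using digraph_dist_eq_0_iff assms by simp
  ultimately consider (one) "digraph_dist G u v = 1" | (two) "digraph_dist G u v = 2"
    by linarith
  then show "u \<rightarrow>\<^bsub>G\<^esub> v \<or> (\<exists>m. u \<rightarrow>\<^bsub>G\<^esub> m \<and> m \<rightarrow>\<^bsub>G\<^esub> v)"
  proof cases
    case one
    then show ?thesis
      using digraph_dist_eq_1_iff[OF assms] by simp
  next
    case two
    then obtain m
      where midpoint: "u \<rightarrow>\<^sup>* m" "m \<rightarrow>\<^sup>* v" "digraph_dist G u m = 1" "digraph_dist G m v = 1"
      using obtain_vertex_on_geodesic[OF assms(1), of 1] by auto
    then have "u \<noteq> m" "m \<noteq> v"
      using digraph_dist_eq_0_iff by (metis one_neq_zero)+
    with midpoint show ?thesis
      using digraph_dist_eq_1_iff by blast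
  qed
next
  assume "u \<rightarrow>\<^bsub>G\<^esub> v \<or> (\<exists>m. u \<rightarrow>\<^bsub>G\<^esub> m \<and> m \<rightarrow>\<^bsub>G\<^esub> v)"
  then show "digraph_dist G u v \<le> 2"
  proof (elim disjE exE conjE)
    assume "u \<rightarrow>\<^bsub>G\<^esub> v"
    then show ?thesis
      using digraph_dist_le_1[of u v] by linarith
  next
    fix m assume midpoint: "u \<rightarrow>\<^bsub>G\<^esub> m" "m \<rightarrow>\<^bsub>G\<^esub> v"
    then have "u \<rightarrow>\<^sup>* m" "m \<rightarrow>\<^sup>* v"
      by blast+
    from digraph_dist_triangle[OF this] show ?thesis
      using digraph_dist_le_1[OF midpoint(1)] digraph_dist_le_1[OF midpoint(2)] by linarith
  qed
qed

end

lemma asymmetric_imp_outer_separated_pair: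
  assumes "{x, y, z} \<subseteq> V" "x \<noteq> y" "y \<noteq> z" "x \<noteq> z" "d x y \<noteq> d y x"
  shows "\<exists>T. outer_separated V (\<lambda>u v. (d u v, d v u)) T \<and> card T = 2"
proof -
  let ?f = "\<lambda>u v. (d u v, d v u)"
  have pair: ?thesis if "u \<in> V" "v \<in> V" "w \<in> V" "u \<noteq> v" "w \<noteq> u" "w \<noteq> v" "?f w u \<noteq> ?f w v" for u v w
  proof (intro exI conjI)
    show "outer_separated V ?f {u, v}"
      using that by (auto simp: outer_separated_def pairwise_insert intro!: bexI[of _ w])
    show "card {u, v} = 2"
      using that(4) by simp
  qed
  have "?f y x \<noteq> ?f y z \<or> ?f z x \<noteq> ?f z y \<or> ?f x y \<noteq> ?f x z"
    using assms(5) by auto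
  then show ?thesis
    using pair[of x z y] pair[of x y z] pair[of y z x] assms(1-4) by blast
qed

locale strong_digraph = fin_digraph +
  assumes strong: "strongly_connected G"
begin

lemma reachable_verts: "\<lbrakk>u \<in> verts G; v \<in> verts G\<rbrakk> \<Longrightarrow> u \<rightarrow>\<^sup>* v"
  using strong by (simp add: strongly_connected_def)

lemma two_way_dist_self_neq:
  assumes "u \<in> verts G" "v \<in> verts G" "u \<noteq> v"
  shows "two_way_dist G u u \<noteq> two_way_dist G u v"
  using assms digraph_dist_eq_0_iff[OF reachable_verts, of u u]
    digraph_dist_eq_0_iff[OF reachable_verts, of u v]
  by (auto simp: two_way_dist_def)

lemma weakly_resolving_iff_outer_separated:
  "weakly_resolving G W \<longleftrightarrow>
    W \<subseteq> verts G \<and> outer_separated (verts G) (two_way_dist G) (verts G - W)"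
proof
  assume resolving: "weakly_resolving G W"
  then have "verts G - (verts G - W) = W"
    by (auto simp: weakly_resolving_def)
  with resolving show "W \<subseteq> verts G \<and> outer_separated (verts G) (two_way_dist G) (verts G - W)"
    by (auto simp: weakly_resolving_def outer_separated_def pairwise_def)
next
  assume separated: "W \<subseteq> verts G \<and> outer_separated (verts G) (two_way_dist G) (verts G - W)"
  have "\<exists>w\<in>W. two_way_dist G w u \<noteq> two_way_dist G w v"
    if vertices: "u \<in> verts G" "v \<in> verts G" "u \<noteq> v" for u v
  proof -
    consider (left) "u \<in> W" | (right) "v \<in> W" | (outside) "u \<in> verts G - W" "v \<in> verts G - W"
      using vertices by blast
    then show ?thesis
    proof cases
      case left
      then show ?thesis
        using two_way_dist_self_neq[OF vertices] by blast
    next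
      case right
      then show ?thesis
        using two_way_dist_self_neq[of v u] vertices by metis
    next
      case outside
      then show ?thesis
        using separated outer_separatedE[OF conjunct2[OF separated] outside vertices(3)] by blast
    qed
  qed
  then show "weakly_resolving G W"
    using separated finite_subset[OF _ finite_verts] by (auto simp: weakly_resolving_def)
qed

lemma weak_metric_dim_le_iff:
  assumes k_le: "k \<le> card (verts G)"
  shows "weak_metric_dim G \<le> card (verts G) - k \<longleftrightarrow>
    (\<exists>T. outer_separated (verts G) (two_way_dist G) T \<and> card T = k)"
proof
  have "outer_separated (verts G) (two_way_dist G) (verts G - verts G)"
    by (simp add: outer_separated_def)
  then have "\<exists>m W. weakly_resolving G W \<and> card W = m"
    by (auto simp: weakly_resolving_iff_outer_separated)
  then obtain W where resolving: "weakly_resolving G W" "card W = weak_metric_dim G"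
    unfolding weak_metric_dim_def using LeastI_ex[of "\<lambda>m. \<exists>W. weakly_resolving G W \<and> card W = m"]
    by auto
  assume "weak_metric_dim G \<le> card (verts G) - k"
  moreover have "W \<subseteq> verts G" "finite W"
    using resolving(1) by (simp_all add: weakly_resolving_def)
  ultimately have "k \<le> card (verts G - W)"
    using resolving(2) k_le by (simp add: card_Diff_subset)
  then obtain T where "T \<subseteq> verts G - W" "card T = k"
    by (meson obtain_subset_with_card_n)
  moreover have "outer_separated (verts G) (two_way_dist G) (verts G - W)"
    using resolving(1) by (simp add: weakly_resolving_iff_outer_separated)
  ultimately show "\<exists>T. outer_separated (verts G) (two_way_dist G) T \<and> card T = k"
    using outer_separated_subset by blast
next
  assume "\<exists>T. outer_separated (verts G) (two_way_dist G) T \<and> card T = k"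
  then obtain T where separated: "outer_separated (verts G) (two_way_dist G) T" "card T = k"
    by blast
  then have "T \<subseteq> verts G"
    by (simp add: outer_separated_def)
  then have "weakly_resolving G (verts G - T)"
    using separated(1) by (simp add: weakly_resolving_iff_outer_separated double_diff)
  moreover have "card (verts G - T) = card (verts G) - k"
    using \<open>T \<subseteq> verts G\<close> separated(2) finite_subset[OF _ finite_verts]
    by (simp add: card_Diff_subset)
  ultimately show "weak_metric_dim G \<le> card (verts G) - k"
    unfolding weak_metric_dim_def by (intro Least_le) blast
qed

lemma separated_triple_if_digraph_dist_gt_2:
  assumes "u \<in> verts G" "v \<in> verts G" "2 < digraph_dist G u v"
  shows "separated_triple (verts G) (two_way_dist G)"
proof -
  have "\<exists>x. x \<in> verts G \<and> digraph_dist G u x = i" if "i \<le> 3" for i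
    using obtain_vertex_on_geodesic[OF reachable_verts[OF assms(1,2)], of i] that assms(3)
    by (metis less_eq_Suc_le numeral_2_eq_2 numeral_3_eq_3 order_trans reachable_in_verts(2))
  then obtain x where level: "\<And>i. i \<le> 3 \<Longrightarrow> x i \<in> verts G \<and> digraph_dist G u (x i) = i"
    by metis
  have "digraph_dist G u u = 0"
    using assms(1) by (simp add: digraph_dist_eq_0_iff)
  then have "u \<in> verts G - {x 1, x 2, x 3}" "x 1 \<noteq> x 2" "x 2 \<noteq> x 3" "x 1 \<noteq> x 3"
    using assms(1) level[of 1] level[of 2] level[of 3] by auto
  moreover have "two_way_dist G u (x i) \<noteq> two_way_dist G u (x j)" if "i \<le> 3" "j \<le> 3" "i \<noteq> j" for i j
    using that level[of i] level[of j] by (auto simp: two_way_dist_def)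
  ultimately show ?thesis
    using level by (intro separated_tripleI[of "x 1" "x 2" "x 3" _ u _ u u]) auto
qed

lemma two_way_dist_eq_iff_adj_type_eq:
  assumes two_step: "\<And>u v. \<lbrakk>u \<in> verts G; v \<in> verts G; u \<noteq> v\<rbrakk> \<Longrightarrow>
      u \<rightarrow>\<^bsub>G\<^esub> v \<or> (\<exists>m. u \<rightarrow>\<^bsub>G\<^esub> m \<and> m \<rightarrow>\<^bsub>G\<^esub> v)"
    and "u \<in> verts G" "v \<in> verts G" "w \<in> verts G" "w \<noteq> u" "w \<noteq> v"
  shows "two_way_dist G w u = two_way_dist G w v \<longleftrightarrow>
    adj_type (dominates G) w u = adj_type (dominates G) w v"
proof -
  have "digraph_dist G x y = (if x \<rightarrow>\<^bsub>G\<^esub> y then 1 else 2)"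
    if vertices: "x \<in> verts G" "y \<in> verts G" "x \<noteq> y" for x y
  proof -
    have "digraph_dist G x y \<le> 2" "digraph_dist G x y \<noteq> 0"
      using vertices two_step digraph_dist_le_2_iff digraph_dist_eq_0_iff reachable_verts by auto
    moreover have "digraph_dist G x y = 1 \<longleftrightarrow> x \<rightarrow>\<^bsub>G\<^esub> y"
      using vertices digraph_dist_eq_1_iff reachable_verts by simp
    ultimately show ?thesis
      by auto
  qed
  with assms(2-) show ?thesis
    by (simp add: two_way_dist_def adj_type_def)
qed

theorem weak_metric_dim_iff_unseparated:
  assumes "loopless_relation (verts G) (dominates G)"
    and order: "4 \<le> card (verts G)" and arc: "single_arc (dominates G) x y"
  shows "weak_metric_dim G = card (verts G) - 2 \<longleftrightarrow> unseparated_relation (verts G) (dominates G)"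
proof -
  interpret loopless_relation "verts G" "dominates G"
    by fact
  let ?two_step = "\<forall>u\<in>verts G. \<forall>v\<in>verts G. u \<noteq> v \<longrightarrow> u \<rightarrow>\<^bsub>G\<^esub> v \<or> (\<exists>m. u \<rightarrow>\<^bsub>G\<^esub> m \<and> m \<rightarrow>\<^bsub>G\<^esub> v)"
  let ?sep = "separated_triple (verts G) (two_way_dist G)"
  have "card {x, y} \<le> 2"
    by (simp add: card_insert_if)
  then have "\<not> verts G \<subseteq> {x, y}"
    using order card_mono[of "{x, y}" "verts G"] by auto
  then obtain z where third: "z \<in> verts G" "z \<noteq> x" "z \<noteq> y"
    by auto
  have "digraph_dist G x y \<noteq> digraph_dist G y x"
    using digraph_dist_eq_1_iff reachable_verts single_arcD[OF arc] arc
    by (metis single_arc_def)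
  then have "\<exists>T. outer_separated (verts G) (two_way_dist G) T \<and> card T = 2"
    using asymmetric_imp_outer_separated_pair[of x y z "verts G" "digraph_dist G"]
      third single_arcD[OF arc] by (auto simp: two_way_dist_def[abs_def])
  then have "weak_metric_dim G = card (verts G) - 2 \<longleftrightarrow> \<not> ?sep"
    using weak_metric_dim_le_iff[of 2] weak_metric_dim_le_iff[of 3] order
    by (auto simp: separated_triple_def)
  also have "\<dots> \<longleftrightarrow> ?two_step \<and> \<not> ?sep"
    using separated_triple_if_digraph_dist_gt_2 digraph_dist_le_2_iff reachable_verts
    by (meson not_less)
  also have "\<dots> \<longleftrightarrow> ?two_step \<and> \<not> separated_triple (verts G) (adj_type (dominates G))"
    using outer_separated_cong[of "verts G" "two_way_dist G" "adj_type (dominates G)"]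
      two_way_dist_eq_iff_adj_type_eq
    by (auto simp: separated_triple_def)
  also have "\<dots> \<longleftrightarrow> unseparated_relation (verts G) (dominates G)"
    using order unfolding unseparated_relation_def unseparated_relation_axioms_def
    by (auto intro: loopless_relation_axioms)
  finally show ?thesis .
qed

end

section \<open>Isomorphism with a generalized lexicographic product\<close>

definition rel_iso :: "('a \<Rightarrow> 'a \<Rightarrow> bool) \<Rightarrow> 'a set \<Rightarrow> 'b pair_pre_digraph \<Rightarrow> bool" where
  "rel_iso E A H \<longleftrightarrow>
    (\<exists>g. bij_betw g A (pverts H) \<and> (\<forall>x\<in>A. \<forall>y\<in>A. E x y \<longleftrightarrow> (g x, g y) \<in> parcs H))"

lemma digraph_iso_imp_rel_iso:
  assumes "digraph_iso G (with_proj H)"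
  shows "rel_iso (dominates G) (verts G) H"
proof -
  obtain f where iso: "pre_digraph.digraph_isomorphism G f" and image: "with_proj H = app_iso f G"
    using assms unfolding digraph_iso_def by blast
  let ?h = "iso_verts f"
  have inj: "inj_on ?h (verts G)" and "wf_digraph G"
    using iso by (simp_all add: pre_digraph.digraph_isomorphism_def)
  then interpret wf_digraph G
    by simp
  have verts: "pverts H = ?h ` verts G" and parcs: "parcs H = iso_arcs f ` arcs G"
    and ends: "iso_tail f = fst" "iso_head f = snd"
    using image by (simp_all add: with_proj_def app_iso_def)
  have "iso_arcs f a = (?h (tail G a), ?h (head G a))" if "a \<in> arcs G" for a
    using iso that by (simp add: digraph_isomorphism_def ends)
  then have "parcs H = (\<lambda>a. (?h (tail G a), ?h (head G a))) ` arcs G"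
    unfolding parcs by (rule image_cong[OF refl])
  then have "x \<rightarrow>\<^bsub>G\<^esub> y \<longleftrightarrow> (?h x, ?h y) \<in> parcs H" if "x \<in> verts G" "y \<in> verts G" for x y
    using that inj by (auto simp: arcs_ends_conv image_iff inj_on_eq_iff)
  then show ?thesis
    using inj verts unfolding rel_iso_def bij_betw_def by blast
qed

lemma (in nomulti_digraph) rel_iso_imp_digraph_iso:
  assumes "rel_iso (dominates G) (verts G) H" and H_wf: "parcs H \<subseteq> pverts H \<times> pverts H"
  shows "digraph_iso G (with_proj H)"
proof -
  obtain h where h_bij: "inj_on h (verts G)" "h ` verts G = pverts H"
    and arcs: "\<And>x y. \<lbrakk>x \<in> verts G; y \<in> verts G\<rbrakk> \<Longrightarrow> x \<rightarrow>\<^bsub>G\<^esub> y \<longleftrightarrow> (h x, h y) \<in> parcs H"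
    using assms(1) unfolding rel_iso_def bij_betw_def by blast
  let ?g = "\<lambda>a. (h (tail G a), h (head G a))"
  let ?f = "\<lparr>iso_verts = h, iso_arcs = ?g, iso_head = snd, iso_tail = fst\<rparr>"
  have "inj_on ?g (arcs G)"
  proof (rule inj_onI)
    fix a b assume "a \<in> arcs G" "b \<in> arcs G" "?g a = ?g b"
    then show "a = b"
      using h_bij(1) by (intro no_multi_arcs) (auto simp: arc_to_ends_def inj_on_eq_iff)
  qed
  then have "digraph_isomorphism ?f"
    using h_bij(1) wf_digraph by (simp add: digraph_isomorphism_def)
  moreover have "?g ` arcs G = parcs H"
  proof (intro equalityI subsetI)
    fix e assume "e \<in> ?g ` arcs G"
    then obtain a where "a \<in> arcs G" "e = ?g a"
      by blast
    then show "e \<in> parcs H"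
      using arcs[of "tail G a" "head G a"] by (auto simp: arcs_ends_conv)
  next
    fix e assume e_arc: "e \<in> parcs H"
    then obtain x y where ends: "e = (h x, h y)" "x \<in> verts G" "y \<in> verts G"
      using H_wf unfolding h_bij(2)[symmetric] by blast
    then have "x \<rightarrow>\<^bsub>G\<^esub> y"
      using arcs e_arc by simp
    then show "e \<in> ?g ` arcs G"
      using ends(1) by (auto simp: arcs_ends_conv)
  qed
  ultimately show ?thesis
    unfolding digraph_iso_def using h_bij(2)
    by (intro exI[of _ ?f]) (simp add: app_iso_def with_proj_def)
qed

lemma pverts_K_digraph [simp]: "pverts (K_digraph t) = {..<t}"
  and parcs_K_digraph [simp]: "parcs (K_digraph t) = {(x, y). x < t \<and> y < t \<and> x \<noteq> y}"
  by (simp_all add: K_digraph_def)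

lemma rel_iso_K_digraph_iff:
  "rel_iso E A (K_digraph t) \<longleftrightarrow> finite A \<and> card A = t \<and> complete_on E A"
proof -
  have "(\<forall>x\<in>A. \<forall>y\<in>A. E x y \<longleftrightarrow> (g x, g y) \<in> parcs (K_digraph t)) \<longleftrightarrow> complete_on E A"
    if "bij_betw g A {..<t}" for g
    using bij_betwE[OF that] inj_on_eq_iff[OF bij_betw_imp_inj_on[OF that]]
    by (auto simp: complete_on_def)
  then have "rel_iso E A (K_digraph t) \<longleftrightarrow> (\<exists>g. bij_betw g A {..<t}) \<and> complete_on E A"
    unfolding rel_iso_def by auto
  also have "(\<exists>g. bij_betw g A {..<t}) \<longleftrightarrow> finite A \<and> card A = t"
    using finite_same_card_bij[of A "{..<t}"] bij_betw_same_card[of _ A "{..<t}"]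
      bij_betw_finite[of _ A "{..<t}"]
    by auto
  finally show ?thesis
    by simp
qed

lemma rel_iso_arcless_digraph_iff:
  "rel_iso E A (arcless_digraph t) \<longleftrightarrow> finite A \<and> card A = t \<and> independent_on E A"
  using finite_same_card_bij[of A "{..<t}"] bij_betw_same_card[of _ A "{..<t}"]
    bij_betw_finite[of _ A "{..<t}"]
  by (auto simp: rel_iso_def arcless_digraph_def independent_on_def)

lemma rel_iso_P2_digraph_iff:
  assumes "\<And>x. \<not> E x x"
  shows "rel_iso E A P2_digraph \<longleftrightarrow> (\<exists>a b. A = {a, b} \<and> single_arc E a b)"
proof
  assume "rel_iso E A P2_digraph"
  then obtain g where "bij_betw g A (pverts P2_digraph)"
    and "\<forall>x\<in>A. \<forall>y\<in>A. E x y \<longleftrightarrow> (g x, g y) \<in> parcs P2_digraph"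
    unfolding rel_iso_def by blast
  then have bij: "bij_betw g A {0, 1}" and arcs: "\<forall>x\<in>A. \<forall>y\<in>A. E x y \<longleftrightarrow> g x = 0 \<and> g y = 1"
    by (simp_all add: P2_digraph_def)
  then obtain a b where ends: "a \<in> A" "b \<in> A" "g a = 0" "g b = 1"
    by (metis bij_betw_imp_surj_on imageE insertI1 insertI2)
  have "x = a \<or> x = b" if "x \<in> A" for x
    using that bij ends bij_betwE[OF bij] inj_onD[OF bij_betw_imp_inj_on[OF bij]] by fastforce
  then have "A = {a, b}"
    using ends by blast
  moreover have "single_arc E a b"
    using arcs ends by (simp add: single_arc_def)
  ultimately show "\<exists>a b. A = {a, b} \<and> single_arc E a b"
    by blast
next
  assume "\<exists>a b. A = {a, b} \<and> single_arc E a b"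
  then obtain a b where ends: "A = {a, b}" "E a b" "\<not> E b a" "a \<noteq> b"
    using assms by (auto simp: single_arc_def)
  define g where "g x = (if x = a then 0 else 1 :: nat)" for x
  have "bij_betw g A {0, 1}"
    using ends by (auto simp: g_def bij_betw_def inj_on_def)
  moreover have "\<forall>x\<in>A. \<forall>y\<in>A. E x y \<longleftrightarrow> (g x, g y) \<in> parcs P2_digraph"
    using ends assms by (auto simp: g_def P2_digraph_def)
  ultimately show "rel_iso E A P2_digraph"
    unfolding rel_iso_def by (intro exI[of _ g]) (simp add: P2_digraph_def)
qed

lemma pverts_gen_lex_prod: "pverts (gen_lex_prod Q Hs) = (SIGMA i:{..<length Hs}. pverts (Hs ! i))"
  by (simp add: gen_lex_prod_def)

lemma parcs_gen_lex_prod_subset: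
  "parcs (gen_lex_prod Q Hs) \<subseteq> pverts (gen_lex_prod Q Hs) \<times> pverts (gen_lex_prod Q Hs)"
  by (auto simp: gen_lex_prod_def)

lemma parcs_gen_lex_prod_iff:
  assumes "p \<in> pverts (gen_lex_prod Q Hs)" "q \<in> pverts (gen_lex_prod Q Hs)"
  shows "(p, q) \<in> parcs (gen_lex_prod Q Hs) \<longleftrightarrow>
    (if fst p = fst q then (snd p, snd q) \<in> parcs (Hs ! fst p) else (fst p, fst q) \<in> parcs Q)"
  using assms by (cases p; cases q) (auto simp: gen_lex_prod_def)

lemma bij_betw_Sigma_fibre:
  assumes bij: "bij_betw h V (Sigma I B)" and "i \<in> I"
  shows "bij_betw (snd \<circ> h) {x \<in> V. fst (h x) = i} (B i)"
proof -
  let ?X = "{x \<in> V. fst (h x) = i}"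
  have "h ` ?X = {p \<in> h ` V. fst p = i}"
    by auto
  also have "\<dots> = Pair i ` B i"
    using bij \<open>i \<in> I\<close> by (auto simp: bij_betw_def)
  finally have "snd ` h ` ?X = snd ` Pair i ` B i"
    by simp
  then have "(snd \<circ> h) ` ?X = B i"
    by (simp add: image_comp)
  moreover have "inj_on (snd \<circ> h) ?X"
    using bij by (auto simp: bij_betw_def inj_on_def prod_eq_iff)
  ultimately show ?thesis
    by (simp add: bij_betw_def)
qed

lemma bij_betw_Sigma_glue:
  assumes range: "c ` V \<subseteq> I" and fibres: "\<And>i. i \<in> I \<Longrightarrow> bij_betw (g i) {x \<in> V. c x = i} (B i)"
  shows "bij_betw (\<lambda>x. (c x, g (c x) x)) V (Sigma I B)" (is "bij_betw ?h _ _")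
  unfolding bij_betw_def
proof (intro conjI equalityI subsetI)
  have c_in_I: "c x \<in> I" if "x \<in> V" for x
    using that range by blast
  show "inj_on ?h V"
  proof (rule inj_onI)
    fix x y assume eq: "x \<in> V" "y \<in> V" "?h x = ?h y"
    then show "x = y"
      using inj_onD[OF bij_betw_imp_inj_on[OF fibres[OF c_in_I[OF eq(1)]]], of x y] by auto
  qed
  show "p \<in> Sigma I B" if "p \<in> ?h ` V" for p
    using that c_in_I bij_betwE[OF fibres] by auto
  show "p \<in> ?h ` V" if "p \<in> Sigma I B" for p
  proof -
    have "fst p \<in> I" "snd p \<in> B (fst p)"
      using that by auto
    then have "snd p \<in> g (fst p) ` {x \<in> V. c x = fst p}"
      using bij_betw_imp_surj_on[OF fibres] by simp
    then obtain x where "x \<in> V" "c x = fst p" "g (fst p) x = snd p"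
      by auto
    then show ?thesis
      by (intro image_eqI[of _ _ x]) simp_all
  qed
qed

lemma rel_iso_gen_lex_prodD:
  assumes "rel_iso E V (gen_lex_prod Q Hs)"
  obtains c where "c ` V \<subseteq> {..<length Hs}"
    and "\<forall>i<length Hs. rel_iso E {x \<in> V. c x = i} (Hs ! i)"
    and "\<forall>x\<in>V. \<forall>y\<in>V. c x \<noteq> c y \<longrightarrow> (E x y \<longleftrightarrow> (c x, c y) \<in> parcs Q)"
proof -
  let ?P = "gen_lex_prod Q Hs"
  obtain h where bij: "bij_betw h V (pverts ?P)"
    and arcs: "\<And>x y. \<lbrakk>x \<in> V; y \<in> V\<rbrakk> \<Longrightarrow> E x y \<longleftrightarrow> (h x, h y) \<in> parcs ?P"
    using assms unfolding rel_iso_def by blast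
  have h_in_prod: "h x \<in> pverts ?P" if "x \<in> V" for x
    using bij that by (rule bij_betwE[THEN bspec])
  have E_iff: "E x y \<longleftrightarrow> (if fst (h x) = fst (h y)
      then (snd (h x), snd (h y)) \<in> parcs (Hs ! fst (h x)) else (fst (h x), fst (h y)) \<in> parcs Q)"
    if "x \<in> V" "y \<in> V" for x y
    using arcs[OF that] parcs_gen_lex_prod_iff[OF h_in_prod[OF that(1)] h_in_prod[OF that(2)]]
    by simp
  show thesis
  proof (rule that[of "\<lambda>x. fst (h x)"])
    show "(\<lambda>x. fst (h x)) ` V \<subseteq> {..<length Hs}"
      using h_in_prod unfolding pverts_gen_lex_prod by (fastforce simp: mem_Sigma_iff split_beta)
    show "\<forall>x\<in>V. \<forall>y\<in>V. fst (h x) \<noteq> fst (h y) \<longrightarrow> (E x y \<longleftrightarrow> (fst (h x), fst (h y)) \<in> parcs Q)"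
      by (simp add: E_iff)
    show "\<forall>i<length Hs. rel_iso E {x \<in> V. fst (h x) = i} (Hs ! i)"
      using bij_betw_Sigma_fibre[OF bij[unfolded pverts_gen_lex_prod]] E_iff
      unfolding rel_iso_def by (fastforce intro: exI[of _ "snd \<circ> h"])
  qed
qed

lemma rel_iso_gen_lex_prodI:
  assumes range: "c ` V \<subseteq> {..<length Hs}"
    and iso: "\<forall>i<length Hs. rel_iso E {x \<in> V. c x = i} (Hs ! i)"
    and quotient: "\<forall>x\<in>V. \<forall>y\<in>V. c x \<noteq> c y \<longrightarrow> (E x y \<longleftrightarrow> (c x, c y) \<in> parcs Q)"
  shows "rel_iso E V (gen_lex_prod Q Hs)"
proof -
  let ?P = "gen_lex_prod Q Hs"
  have "\<forall>i. \<exists>g. i < length Hs \<longrightarrow> bij_betw g {x \<in> V. c x = i} (pverts (Hs ! i)) \<and>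
      (\<forall>x\<in>{x \<in> V. c x = i}. \<forall>y\<in>{x \<in> V. c x = i}. E x y \<longleftrightarrow> (g x, g y) \<in> parcs (Hs ! i))"
    using iso unfolding rel_iso_def by blast
  from choice[OF this] obtain g
    where fibre_bij: "\<And>i. i < length Hs \<Longrightarrow> bij_betw (g i) {x \<in> V. c x = i} (pverts (Hs ! i))"
      and E_iff: "\<And>i x y. \<lbrakk>i < length Hs; x \<in> V; c x = i; y \<in> V; c y = i\<rbrakk> \<Longrightarrow>
        E x y \<longleftrightarrow> (g i x, g i y) \<in> parcs (Hs ! i)"
    by auto
  define h where "h x = (c x, g (c x) x)" for x
  have h_bij: "bij_betw h V (pverts ?P)"
    unfolding h_def pverts_gen_lex_prod using range fibre_bij by (intro bij_betw_Sigma_glue) auto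
  moreover have "E x y \<longleftrightarrow> (h x, h y) \<in> parcs ?P" if vertices: "x \<in> V" "y \<in> V" for x y
  proof -
    have "h x \<in> pverts ?P" "h y \<in> pverts ?P"
      using bij_betwE[OF h_bij] vertices by blast+
    then have "(h x, h y) \<in> parcs ?P \<longleftrightarrow>
        (if c x = c y then (g (c x) x, g (c x) y) \<in> parcs (Hs ! c x) else (c x, c y) \<in> parcs Q)"
      using parcs_gen_lex_prod_iff[of "h x" Q Hs "h y"] by (simp add: h_def)
    moreover have "c x < length Hs"
      using range vertices(1) by blast
    ultimately show ?thesis
      using E_iff[of "c x" x y] quotient vertices by simp
  qed
  ultimately show ?thesis
    unfolding rel_iso_def by blast
qed

lemma lex_partition_fibres:
  assumes "c ` V \<subseteq> {..<3}" "{x \<in> V. c x = 0} \<noteq> {}" "{x \<in> V. c x = 1} \<noteq> {}" "{x \<in> V. c x = 2} \<noteq> {}"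
    and "\<forall>x\<in>V. \<forall>y\<in>V. c x \<noteq> c y \<longrightarrow> (E x y \<longleftrightarrow> (c x, c y) \<in> parcs Q)"
  shows "lex_partition Q E V {x \<in> V. c x = 0} {x \<in> V. c x = 1} {x \<in> V. c x = 2}"
proof -
  have "c x = 0 \<or> c x = 1 \<or> c x = 2" if "x \<in> V" for x
  proof -
    have "c x < 3"
      using that assms(1) by blast
    then show ?thesis
      by linarith
  qed
  then show ?thesis
    using assms(2-5) by (auto simp: lex_partition_def tripartition_def adj_type_def)
qed

lemma lex_partition_fibresE:
  assumes "lex_partition Q E V A B C"
  obtains c where "c ` V \<subseteq> {..<3}"
    and "{x \<in> V. c x = 0} = A" "{x \<in> V. c x = 1} = B" "{x \<in> V. c x = 2} = C"
    and "\<forall>x\<in>V. \<forall>y\<in>V. c x \<noteq> c y \<longrightarrow> (E x y \<longleftrightarrow> (c x, c y) \<in> parcs Q)"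
proof -
  define c where "c x = (if x \<in> A then 0 else if x \<in> B then 1 else 2 :: nat)" for x
  have "c ` V \<subseteq> {..<3}"
    by (auto simp: c_def)
  moreover have "{x \<in> V. c x = 0} = A" "{x \<in> V. c x = 1} = B" "{x \<in> V. c x = 2} = C"
    using assms by (auto simp: lex_partition_def tripartition_def c_def)
  moreover have "\<forall>x\<in>V. \<forall>y\<in>V. c x \<noteq> c y \<longrightarrow> (E x y \<longleftrightarrow> (c x, c y) \<in> parcs Q)"
    using assms
    by (auto simp: lex_partition_def tripartition_def c_def adj_type_def split: if_splits)
  ultimately show thesis
    by (rule that)
qed

lemma rel_iso_gen_lex_prod3_iff:
  assumes "pverts H0 \<noteq> {}" "pverts H1 \<noteq> {}" "pverts H2 \<noteq> {}"
  shows "rel_iso E V (gen_lex_prod Q [H0, H1, H2]) \<longleftrightarrow>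
    (\<exists>A B C. lex_partition Q E V A B C \<and> rel_iso E A H0 \<and> rel_iso E B H1 \<and> rel_iso E C H2)"
    (is "_ \<longleftrightarrow> ?R")
proof
  assume "rel_iso E V (gen_lex_prod Q [H0, H1, H2])"
  then obtain c where range: "c ` V \<subseteq> {..<length [H0, H1, H2]}"
    and iso: "\<forall>i<length [H0, H1, H2]. rel_iso E {x \<in> V. c x = i} ([H0, H1, H2] ! i)"
    and quotient: "\<forall>x\<in>V. \<forall>y\<in>V. c x \<noteq> c y \<longrightarrow> (E x y \<longleftrightarrow> (c x, c y) \<in> parcs Q)"
    by (rule rel_iso_gen_lex_prodD)
  let ?X = "\<lambda>i. {x \<in> V. c x = i}"
  have isos: "rel_iso E (?X 0) H0" "rel_iso E (?X 1) H1" "rel_iso E (?X 2) H2"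
    using iso[rule_format, of 0] iso[rule_format, of 1] iso[rule_format, of 2] by simp_all
  then have "?X 0 \<noteq> {}" "?X 1 \<noteq> {}" "?X 2 \<noteq> {}"
    using assms by (auto simp: rel_iso_def bij_betw_def)
  then have "lex_partition Q E V (?X 0) (?X 1) (?X 2)"
    using range quotient by (intro lex_partition_fibres) (simp_all add: numeral_3_eq_3)
  with isos show ?R
    by blast
next
  assume ?R
  then obtain A B C where "lex_partition Q E V A B C"
    and isos: "rel_iso E A H0" "rel_iso E B H1" "rel_iso E C H2"
    by blast
  then obtain c where range: "c ` V \<subseteq> {..<3}"
    and fibres: "{x \<in> V. c x = 0} = A" "{x \<in> V. c x = 1} = B" "{x \<in> V. c x = 2} = C"
    and quotient: "\<forall>x\<in>V. \<forall>y\<in>V. c x \<noteq> c y \<longrightarrow> (E x y \<longleftrightarrow> (c x, c y) \<in> parcs Q)"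
    by (elim lex_partition_fibresE)
  have "rel_iso E {x \<in> V. c x = i} ([H0, H1, H2] ! i)" if i_less: "i < length [H0, H1, H2]" for i
  proof -
    consider "i = 0" | "i = 1" | "i = 2"
      using i_less by fastforce
    then show ?thesis
      using isos by cases (simp_all only: fibres, simp_all)
  qed
  then show "rel_iso E V (gen_lex_prod Q [H0, H1, H2])"
    using range quotient by (intro rel_iso_gen_lex_prodI) (simp_all add: numeral_3_eq_3)
qed

section \<open>The classification\<close>

lemma lex_partition_finite_parts:
  assumes "lex_partition Q E V A B C" "finite V"
  shows "finite A" "finite B" "finite C"
  using assms by (auto simp: lex_partition_def tripartition_def)

lemma lex_partition_card:
  assumes "lex_partition Q E V A B C" "finite V"
  shows "card V = card A + card B + card C" "0 < card A" "0 < card B" "0 < card C"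
  using assms lex_partition_finite_parts[OF assms]
  by (auto simp: lex_partition_def tripartition_def card_Un_disjoint Int_Un_distrib2 card_gt_0_iff)

context loopless_relation
begin

lemma rel_iso_K1_iff: "rel_iso E A (K_digraph 1) \<longleftrightarrow> (\<exists>z. A = {z})"
  using complete_on_singleton by (auto simp: rel_iso_K_digraph_iff card_1_singleton_iff)

lemma rel_iso_K_K_K_iff:
  assumes "finite V" "0 < i" "0 < j" "0 < k"
  shows "rel_iso E V (gen_lex_prod Q [K_digraph i, K_digraph j, K_digraph k]) \<longleftrightarrow>
    (\<exists>A B C. lex_partition Q E V A B C \<and> complete_on E A \<and> complete_on E B \<and> complete_on E C \<and>
      card A = i \<and> card B = j \<and> card C = k)"
proof -
  have "rel_iso E V (gen_lex_prod Q [K_digraph i, K_digraph j, K_digraph k]) \<longleftrightarrow>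
    (\<exists>A B C. lex_partition Q E V A B C \<and>
      rel_iso E A (K_digraph i) \<and> rel_iso E B (K_digraph j) \<and> rel_iso E C (K_digraph k))"
    using assms(2-4) by (intro rel_iso_gen_lex_prod3_iff) (auto simp: lessThan_empty_iff)
  then show ?thesis
    using lex_partition_finite_parts[OF _ assms(1)] unfolding rel_iso_K_digraph_iff by blast
qed

lemma rel_iso_K1_K_K_iff:
  assumes "finite V"
  shows "(\<exists>t. 1 \<le> t \<and> t \<le> card V - 2 \<and>
      rel_iso E V (gen_lex_prod Q [K_digraph 1, K_digraph t, K_digraph (card V - t - 1)])) \<longleftrightarrow>
    (\<exists>z B C. lex_partition Q E V {z} B C \<and> complete_on E B \<and> complete_on E C)"
    (is "?L \<longleftrightarrow> ?R")
proof -
  have sizes: "1 \<le> card B \<and> card B \<le> card V - 2 \<and> card C = card V - card B - 1"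
    if "lex_partition Q E V A B C" "card A = 1" for A B C
    using lex_partition_card[OF that(1) assms] that(2) by auto
  have "?L \<longleftrightarrow> (\<exists>t. 1 \<le> t \<and> t \<le> card V - 2 \<and> (\<exists>A B C. lex_partition Q E V A B C \<and>
      complete_on E A \<and> complete_on E B \<and> complete_on E C \<and>
      card A = 1 \<and> card B = t \<and> card C = card V - t - 1))"
    by (intro ex_cong1 conj_cong refl rel_iso_K_K_K_iff[OF assms]) auto
  also have "\<dots> \<longleftrightarrow> (\<exists>A B C. lex_partition Q E V A B C \<and>
      complete_on E A \<and> complete_on E B \<and> complete_on E C \<and> card A = 1)"
    using sizes by blast
  also have "\<dots> \<longleftrightarrow> ?R"
    using complete_on_singleton by (simp add: card_1_singleton_iff) blast
  finally show ?thesis .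
qed

lemma rel_iso_K_K_K1_iff:
  assumes "finite V"
  shows "(\<exists>t. 1 \<le> t \<and> t \<le> card V - 2 \<and>
      rel_iso E V (gen_lex_prod Q [K_digraph t, K_digraph (card V - t - 1), K_digraph 1])) \<longleftrightarrow>
    (\<exists>A B z. lex_partition Q E V A B {z} \<and> complete_on E A \<and> complete_on E B)"
    (is "?L \<longleftrightarrow> ?R")
proof -
  have sizes: "1 \<le> card A \<and> card A \<le> card V - 2 \<and> card B = card V - card A - 1"
    if "lex_partition Q E V A B C" "card C = 1" for A B C
    using lex_partition_card[OF that(1) assms] that(2) by auto
  have "?L \<longleftrightarrow> (\<exists>t. 1 \<le> t \<and> t \<le> card V - 2 \<and> (\<exists>A B C. lex_partition Q E V A B C \<and>
      complete_on E A \<and> complete_on E B \<and> complete_on E C \<and>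
      card A = t \<and> card B = card V - t - 1 \<and> card C = 1))"
    by (intro ex_cong1 conj_cong refl rel_iso_K_K_K_iff[OF assms]) auto
  also have "\<dots> \<longleftrightarrow> (\<exists>A B C. lex_partition Q E V A B C \<and>
      complete_on E A \<and> complete_on E B \<and> complete_on E C \<and> card C = 1)"
    using sizes by blast
  also have "\<dots> \<longleftrightarrow> ?R"
    using complete_on_singleton by (simp add: card_1_singleton_iff) blast
  finally show ?thesis .
qed

lemma rel_iso_K1_P2_K1_iff:
  "rel_iso E V (gen_lex_prod Q [K_digraph 1, P2_digraph, K_digraph 1]) \<longleftrightarrow>
    (\<exists>p a b q. lex_partition Q E V {p} {a, b} {q} \<and> single_arc E a b)"
proof -
  have "rel_iso E V (gen_lex_prod Q [K_digraph 1, P2_digraph, K_digraph 1]) \<longleftrightarrow>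
    (\<exists>A B C. lex_partition Q E V A B C \<and>
      rel_iso E A (K_digraph 1) \<and> rel_iso E B P2_digraph \<and> rel_iso E C (K_digraph 1))"
    by (rule rel_iso_gen_lex_prod3_iff) (simp_all add: P2_digraph_def lessThan_empty_iff)
  then show ?thesis
    unfolding rel_iso_K1_iff rel_iso_P2_digraph_iff[OF E_irrefl] by blast
qed

lemma rel_iso_K1_arcless_K1_iff:
  assumes "2 < card V"
  shows "rel_iso E V (gen_lex_prod Q [K_digraph 1, arcless_digraph (card V - 2), K_digraph 1]) \<longleftrightarrow>
    (\<exists>p B q. lex_partition Q E V {p} B {q} \<and> independent_on E B)"
proof -
  have "finite V"
    using assms card_gt_0_iff by fastforce
  have "rel_iso E V (gen_lex_prod Q [K_digraph 1, arcless_digraph (card V - 2), K_digraph 1]) \<longleftrightarrow>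
    (\<exists>A B C. lex_partition Q E V A B C \<and> rel_iso E A (K_digraph 1) \<and>
      rel_iso E B (arcless_digraph (card V - 2)) \<and> rel_iso E C (K_digraph 1))"
    using assms
    by (intro rel_iso_gen_lex_prod3_iff) (auto simp: arcless_digraph_def lessThan_empty_iff)
  moreover have "finite B \<and> card B = card V - 2" if "lex_partition Q E V {p} B {q}" for p B q
    using lex_partition_finite_parts[OF that \<open>finite V\<close>] lex_partition_card[OF that \<open>finite V\<close>]
    by simp
  ultimately show ?thesis
    unfolding rel_iso_K1_iff rel_iso_arcless_digraph_iff by blast
qed

theorem extremal_iff_rel_iso:
  assumes "card V = n" "4 \<le> n"
  shows "extremal E V \<longleftrightarrow>
    (rel_iso E V (gen_lex_prod G2_digraph [K_digraph 1, P2_digraph, K_digraph 1]) \<or>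
     (\<exists>t. 1 \<le> t \<and> t \<le> n - 2 \<and>
       (rel_iso E V (gen_lex_prod G1_digraph [K_digraph 1, K_digraph t, K_digraph (n - t - 1)]) \<or>
        rel_iso E V (gen_lex_prod G2_digraph [K_digraph 1, K_digraph t, K_digraph (n - t - 1)]) \<or>
        rel_iso E V (gen_lex_prod G2_digraph [K_digraph t, K_digraph (n - t - 1), K_digraph 1]))) \<or>
     rel_iso E V (gen_lex_prod G2_digraph [K_digraph 1, arcless_digraph (n - 2), K_digraph 1]))"
proof -
  have "finite V" "2 < card V"
    using assms card_gt_0_iff by fastforce+
  note iffs = rel_iso_K1_K_K_iff[OF this(1)] rel_iso_K_K_K1_iff[OF this(1)]
    rel_iso_K1_P2_K1_iff rel_iso_K1_arcless_K1_iff[OF this(2)]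
  show ?thesis
    unfolding extremal.simps assms(1)[symmetric] conj_disj_distribL ex_disj_distrib iffs by blast
qed

end

lemma (in nomulti_digraph) digraph_iso_gen_lex_prod_iff:
  "digraph_iso G (with_proj (gen_lex_prod Q Hs)) \<longleftrightarrow>
    rel_iso (dominates G) (verts G) (gen_lex_prod Q Hs)"
  using digraph_iso_imp_rel_iso rel_iso_imp_digraph_iso parcs_gen_lex_prod_subset by blast

lemma (in loopfree_digraph) loopless_relation_dominates: "loopless_relation (verts G) (dominates G)"
  using adj_in_verts adj_not_same by unfold_locales blast+

theorem theorem4p2:
  fixes \<Gamma> :: "('a, 'b) pre_digraph" and n :: nat
  assumes "digraph \<Gamma>"
    and "strongly_connected \<Gamma>"
    and "card (verts \<Gamma>) = n"
    and "n \<ge> 4"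
    and "\<not> symmetric \<Gamma>"
  shows "weak_metric_dim \<Gamma> = n - 2 \<longleftrightarrow>
    (digraph_iso \<Gamma> (with_proj (gen_lex_prod G2_digraph [K_digraph 1, P2_digraph, K_digraph 1])) \<or>
     (\<exists>t. 1 \<le> t \<and> t \<le> n - 2 \<and>
       (digraph_iso \<Gamma> (with_proj (gen_lex_prod G1_digraph [K_digraph 1, K_digraph t, K_digraph (n - t - 1)])) \<or>
        digraph_iso \<Gamma> (with_proj (gen_lex_prod G2_digraph [K_digraph 1, K_digraph t, K_digraph (n - t - 1)])) \<or>
        digraph_iso \<Gamma> (with_proj (gen_lex_prod G2_digraph [K_digraph t, K_digraph (n - t - 1), K_digraph 1])))) \<or>
     digraph_iso \<Gamma> (with_proj (gen_lex_prod G2_digraph [K_digraph 1, arcless_digraph (n - 2), K_digraph 1])))"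
proof -
  interpret digraph \<Gamma> by fact
  interpret strong_digraph \<Gamma> by unfold_locales fact
  interpret loopless_relation "verts \<Gamma>" "dominates \<Gamma>"
    by (rule loopless_relation_dominates)
  obtain x y where arc: "single_arc (dominates \<Gamma>) x y"
    using assms(5) by (auto simp: symmetric_def sym_def single_arc_def)
  have "weak_metric_dim \<Gamma> = n - 2 \<longleftrightarrow> unseparated_relation (verts \<Gamma>) (dominates \<Gamma>)"
    using weak_metric_dim_iff_unseparated[OF loopless_relation_axioms _ arc] assms(3,4) by simp
  also have "\<dots> \<longleftrightarrow> extremal (dominates \<Gamma>) (verts \<Gamma>)"
    using assms(3,4) arc by (intro unseparated_iff_extremal) simp_all
  finally show ?thesis
    unfolding digraph_iso_gen_lex_prod_iff using extremal_iff_rel_iso[OF assms(3,4)] by simp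
qed

end
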